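(* For every integer $r>1$ the group algebras $\mathbb{C}[\mathrm{SL}_2(\mathbb{Z}/2^{2r}\mathbb{Z})]$ and $\mathbb{C}[\mathrm{SL}_2(\mathbb{F}_2[t]/(t^{2r}))]$ are not isomorphic.
   Context: Isomorphism means isomorphism of $\mathbb{C}$-algebras. *)

theory Defs
  imports
    Complex_Main
    "HOL-Algebra.Algebra"
    "HOL-Algebra.Algebraic_Closure_Type"
    "HOL-Number_Theory.Residues"
begin

section \<open>The special linear group of degree two over a ring\<close>

text \<open>The tuple \<open>(a, b, c, d)\<close> stands for the matrix with rows \<open>(a, b)\<close> and \<open>(c, d)\<close>.\<close>

definition SL2 :: "('a, 'm) ring_scheme \<Rightarrow> ('a \<times> 'a \<times> 'a \<times> 'a) monoid" where
  "SL2 R = \<lparr>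
     carrier = {(a, b, c, d). a \<in> carrier R \<and> b \<in> carrier R \<and> c \<in> carrier R \<and> d \<in> carrier R \<and>
                  a \<otimes>\<^bsub>R\<^esub> d \<ominus>\<^bsub>R\<^esub> b \<otimes>\<^bsub>R\<^esub> c = \<one>\<^bsub>R\<^esub>},
     monoid.mult = (\<lambda>(a, b, c, d) (a', b', c', d').
       (a \<otimes>\<^bsub>R\<^esub> a' \<oplus>\<^bsub>R\<^esub> b \<otimes>\<^bsub>R\<^esub> c', a \<otimes>\<^bsub>R\<^esub> b' \<oplus>\<^bsub>R\<^esub> b \<otimes>\<^bsub>R\<^esub> d',
        c \<otimes>\<^bsub>R\<^esub> a' \<oplus>\<^bsub>R\<^esub> d \<otimes>\<^bsub>R\<^esub> c', c \<otimes>\<^bsub>R\<^esub> b' \<oplus>\<^bsub>R\<^esub> d \<otimes>\<^bsub>R\<^esub> d')),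
     one = (\<one>\<^bsub>R\<^esub>, \<zero>\<^bsub>R\<^esub>, \<zero>\<^bsub>R\<^esub>, \<one>\<^bsub>R\<^esub>)\<rparr>"

lemma (in cring) group_SL2: "group (SL2 R)"
proof (rule groupI)
  fix x y assume "x \<in> carrier (SL2 R)" "y \<in> carrier (SL2 R)"
  then obtain a b c d a' b' c' d' where xy: "x = (a, b, c, d)" "y = (a', b', c', d')"
    and R: "a \<in> carrier R" "b \<in> carrier R" "c \<in> carrier R" "d \<in> carrier R"
      "a' \<in> carrier R" "b' \<in> carrier R" "c' \<in> carrier R" "d' \<in> carrier R"
    and det: "a \<otimes> d \<ominus> b \<otimes> c = \<one>" "a' \<otimes> d' \<ominus> b' \<otimes> c' = \<one>"
    by (auto simp: SL2_def)
  have "(a \<otimes> a' \<oplus> b \<otimes> c') \<otimes> (c \<otimes> b' \<oplus> d \<otimes> d') \<ominus> (a \<otimes> b' \<oplus> b \<otimes> d') \<otimes> (c \<otimes> a' \<oplus> d \<otimes> c')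
      = (a \<otimes> d \<ominus> b \<otimes> c) \<otimes> (a' \<otimes> d' \<ominus> b' \<otimes> c')"
    using R by algebra
  then show "x \<otimes>\<^bsub>SL2 R\<^esub> y \<in> carrier (SL2 R)"
    using R det by (simp add: xy SL2_def)
next
  show "\<one>\<^bsub>SL2 R\<^esub> \<in> carrier (SL2 R)"
    by (simp add: SL2_def minus_eq)
next
  fix x y z
  assume "x \<in> carrier (SL2 R)" "y \<in> carrier (SL2 R)" "z \<in> carrier (SL2 R)"
  then show "x \<otimes>\<^bsub>SL2 R\<^esub> y \<otimes>\<^bsub>SL2 R\<^esub> z = x \<otimes>\<^bsub>SL2 R\<^esub> (y \<otimes>\<^bsub>SL2 R\<^esub> z)"
    by (auto simp: SL2_def l_distr r_distr m_assoc a_ac)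
next
  fix x assume "x \<in> carrier (SL2 R)"
  then show "\<one>\<^bsub>SL2 R\<^esub> \<otimes>\<^bsub>SL2 R\<^esub> x = x"
    by (auto simp: SL2_def)
next
  fix x assume "x \<in> carrier (SL2 R)"
  then obtain a b c d where x: "x = (a, b, c, d)"
    and R: "a \<in> carrier R" "b \<in> carrier R" "c \<in> carrier R" "d \<in> carrier R"
    and det: "a \<otimes> d \<ominus> b \<otimes> c = \<one>"
    by (auto simp: SL2_def)
  let ?y = "(d, \<ominus> b, \<ominus> c, a)"
  have "d \<otimes> a \<ominus> (\<ominus> b) \<otimes> (\<ominus> c) = a \<otimes> d \<ominus> b \<otimes> c" "d \<otimes> a \<oplus> (\<ominus> b) \<otimes> c = a \<otimes> d \<ominus> b \<otimes> c"
    "d \<otimes> b \<oplus> (\<ominus> b) \<otimes> d = \<zero>" "(\<ominus> c) \<otimes> a \<oplus> a \<otimes> c = \<zero>" "(\<ominus> c) \<otimes> b \<oplus> a \<otimes> d = a \<otimes> d \<ominus> b \<otimes> c"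
    using R by algebra+
  then have "?y \<in> carrier (SL2 R)" "?y \<otimes>\<^bsub>SL2 R\<^esub> x = \<one>\<^bsub>SL2 R\<^esub>"
    using R det by (simp_all add: x SL2_def)
  then show "\<exists>y\<in>carrier (SL2 R). y \<otimes>\<^bsub>SL2 R\<^esub> x = \<one>\<^bsub>SL2 R\<^esub>"
    by blast
qed


section \<open>Truncated polynomial rings\<close>

text \<open>The ring \<open>R[t]/(t\<^sup>n)\<close>.\<close>

definition truncated_poly_ring :: "('a, 'm) ring_scheme \<Rightarrow> nat \<Rightarrow> (nat \<Rightarrow> 'a) set ring" where
  "truncated_poly_ring R n = UP R Quot (PIdl\<^bsub>UP R\<^esub> (up_ring.monom (UP R) \<one>\<^bsub>R\<^esub> n))"

lemma (in cring) cring_truncated_poly_ring: "cring (truncated_poly_ring R n)"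
proof -
  note one = one_closed
  interpret UP_cring R "UP R" by (simp add: UP_cring_def cring_axioms)
  show ?thesis
    unfolding truncated_poly_ring_def
    by (intro ideal.quotient_is_cring P.cgenideal_ideal P.cring_axioms monom_closed one)
qed


section \<open>Complex group algebras\<close>

text \<open>
  The element \<open>f\<close> of \<open>complex_group_algebra G\<close> stands for the formal linear combination
  \<open>\<Sum>x\<in>carrier G. f x \<cdot> x\<close>. The library locale for algebras only covers commutative ones, but its
  record type still provides the required operations.
\<close>

definition complex_group_algebra :: "('g, 'm) monoid_scheme \<Rightarrow> (complex, 'g \<Rightarrow> complex) module" where
  "complex_group_algebra G = \<lparr>
     carrier = {f. {x. f x \<noteq> 0} \<subseteq> carrier G \<and> finite {x. f x \<noteq> 0}},
     monoid.mult = (\<lambda>f g x. \<Sum>(y, z) \<in> {(y, z). f y \<noteq> 0 \<and> g z \<noteq> 0 \<and> y \<otimes>\<^bsub>G\<^esub> z = x}. f y * g z),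
     one = (\<lambda>x. if x = \<one>\<^bsub>G\<^esub> then 1 else 0),
     ring.zero = (\<lambda>x. 0),
     add = (\<lambda>f g x. f x + g x),
     module.smult = (\<lambda>c f x. c * f x)\<rparr>"

text \<open>Isomorphism of unital complex algebras: a linear isomorphism of rings.\<close>

definition complex_algebra_isomorphic ::
  "(complex, 'a) module \<Rightarrow> (complex, 'b) module \<Rightarrow> bool" where
  "complex_algebra_isomorphic A B \<longleftrightarrow>
     (\<exists>h \<in> ring_iso A B. \<forall>c. \<forall>x \<in> carrier A. h (c \<odot>\<^bsub>A\<^esub> x) = c \<odot>\<^bsub>B\<^esub> h x)"

lemma complex_group_algebra_mult:
  assumes "finite A" "finite B" "{x. f x \<noteq> 0} \<subseteq> A" "{x. g x \<noteq> 0} \<subseteq> B"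
  shows "(f \<otimes>\<^bsub>complex_group_algebra G\<^esub> g) x =
    (\<Sum>y\<in>A. \<Sum>z\<in>B. f y * g z * (if y \<otimes>\<^bsub>G\<^esub> z = x then 1 else 0))"
proof -
  have "(f \<otimes>\<^bsub>complex_group_algebra G\<^esub> g) x =
      (\<Sum>(y, z)\<in>A \<times> B. f y * g z * (if y \<otimes>\<^bsub>G\<^esub> z = x then 1 else 0))"
    unfolding complex_group_algebra_def using assms
    by (auto intro!: sum.mono_neutral_cong_left split: if_splits)
  then show ?thesis by (simp add: sum.cartesian_product)
qed

lemma complex_group_algebra_mult_sum:
  assumes "finite A" "finite B" "{x. f x \<noteq> 0} \<subseteq> A" "{x. g x \<noteq> 0} \<subseteq> B"
    and "finite C" "\<And>y z. y \<in> A \<Longrightarrow> z \<in> B \<Longrightarrow> y \<otimes>\<^bsub>G\<^esub> z \<in> C"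
  shows "(\<Sum>x\<in>C. (f \<otimes>\<^bsub>complex_group_algebra G\<^esub> g) x * h x) =
    (\<Sum>y\<in>A. \<Sum>z\<in>B. f y * g z * h (y \<otimes>\<^bsub>G\<^esub> z))"
proof -
  have "(\<Sum>x\<in>C. (f \<otimes>\<^bsub>complex_group_algebra G\<^esub> g) x * h x) =
    (\<Sum>x\<in>C. \<Sum>y\<in>A. \<Sum>z\<in>B. f y * g z * (if y \<otimes>\<^bsub>G\<^esub> z = x then 1 else 0) * h x)"
    by (simp add: complex_group_algebra_mult[OF assms(1-4)] sum_distrib_right)
  also have "\<dots> = (\<Sum>y\<in>A. \<Sum>x\<in>C. \<Sum>z\<in>B. f y * g z * (if y \<otimes>\<^bsub>G\<^esub> z = x then 1 else 0) * h x)"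
    by (rule sum.swap)
  also have "\<dots> = (\<Sum>y\<in>A. \<Sum>z\<in>B. \<Sum>x\<in>C. f y * g z * (if y \<otimes>\<^bsub>G\<^esub> z = x then 1 else 0) * h x)"
    by (intro sum.cong refl sum.swap)
  also have "\<dots> = (\<Sum>y\<in>A. \<Sum>z\<in>B. f y * g z * h (y \<otimes>\<^bsub>G\<^esub> z))"
  proof (intro sum.cong refl)
    fix y z assume "y \<in> A" "z \<in> B"
    have "(\<Sum>x\<in>C. f y * g z * (if y \<otimes>\<^bsub>G\<^esub> z = x then 1 else 0) * h x) =
        (\<Sum>x\<in>C. if y \<otimes>\<^bsub>G\<^esub> z = x then f y * g z * h x else 0)"
      by (intro sum.cong) auto
    with assms(5,6) \<open>y \<in> A\<close> \<open>z \<in> B\<close>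
    show "(\<Sum>x\<in>C. f y * g z * (if y \<otimes>\<^bsub>G\<^esub> z = x then 1 else 0) * h x) = f y * g z * h (y \<otimes>\<^bsub>G\<^esub> z)"
      by simp
  qed
  finally show ?thesis .
qed

lemma complex_group_algebra_mult_support:
  assumes "(f \<otimes>\<^bsub>complex_group_algebra G\<^esub> g) x \<noteq> 0"
  obtains y z where "f y \<noteq> 0" "g z \<noteq> 0" "x = y \<otimes>\<^bsub>G\<^esub> z"
proof -
  from assms have "{(y, z). f y \<noteq> 0 \<and> g z \<noteq> 0 \<and> y \<otimes>\<^bsub>G\<^esub> z = x} \<noteq> {}"
    by (auto simp: complex_group_algebra_def simp del: Collect_empty_eq dest: sum.not_neutral_contains_not_neutral)
  then show thesis using that by auto
qed

lemma (in monoid) ring_complex_group_algebra: "ring (complex_group_algebra G)"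
proof -
  let ?A = "complex_group_algebra G"
  define S where "S f = {x. f x \<noteq> (0::complex)}" for f :: "'a \<Rightarrow> complex"
  have carr: "f \<in> carrier ?A \<longleftrightarrow> S f \<subseteq> carrier G \<and> finite (S f)" for f
    by (auto simp: complex_group_algebra_def S_def)
  have add: "f \<oplus>\<^bsub>?A\<^esub> g = (\<lambda>x. f x + g x)" for f g
    by (simp add: complex_group_algebra_def)
  have zero: "\<zero>\<^bsub>?A\<^esub> = (\<lambda>x. 0)" and one: "\<one>\<^bsub>?A\<^esub> = (\<lambda>x. if x = \<one> then 1 else 0)"
    by (simp_all add: complex_group_algebra_def)
  note mult = complex_group_algebra_mult[where G = G, folded S_def]
  note mult_sum = complex_group_algebra_mult_sum[where G = G, folded S_def]
  define P where "P U V = (\<lambda>(y, z). y \<otimes> z) ` (U \<times> V)" for U V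
  have P: "finite (P U V)" if "finite U" "finite V" for U V using that by (simp add: P_def)
  have P_mem: "y \<otimes> z \<in> P U V" if "y \<in> U" "z \<in> V" for y z U V using that by (auto simp: P_def)
  have SP: "S (f \<otimes>\<^bsub>?A\<^esub> g) \<subseteq> P (S f) (S g)" for f g
  proof
    fix x assume "x \<in> S (f \<otimes>\<^bsub>?A\<^esub> g)"
    then obtain y z where "f y \<noteq> 0" "g z \<noteq> 0" "x = y \<otimes> z"
      unfolding S_def by (auto elim: complex_group_algebra_mult_support)
    then show "x \<in> P (S f) (S g)" by (auto simp: P_def S_def)
  qed
  have S_add: "S (f \<oplus>\<^bsub>?A\<^esub> g) \<subseteq> S f \<union> S g" for f g by (auto simp: S_def add)
  have mult_closed: "f \<otimes>\<^bsub>?A\<^esub> g \<in> carrier ?A" if "f \<in> carrier ?A" "g \<in> carrier ?A" for f g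
  proof -
    have "P (S f) (S g) \<subseteq> carrier G" using that by (auto simp: P_def carr)
    then show ?thesis using SP[of f g] that P[of "S f" "S g"] unfolding carr
      by (meson finite_subset subset_trans)
  qed
  have add_closed: "f \<oplus>\<^bsub>?A\<^esub> g \<in> carrier ?A" if "f \<in> carrier ?A" "g \<in> carrier ?A" for f g
    using that S_add[of f g] unfolding carr by (meson finite_UnI finite_subset le_sup_iff subset_trans)
  show ?thesis
  proof (rule ringI)
    show "abelian_group ?A"
    proof (rule abelian_groupI)
      show "f \<oplus>\<^bsub>?A\<^esub> g \<in> carrier ?A" if "f \<in> carrier ?A" "g \<in> carrier ?A" for f g
        using that by (rule add_closed)
      show "\<zero>\<^bsub>?A\<^esub> \<in> carrier ?A" by (simp add: carr zero S_def)
      show "\<exists>g\<in>carrier ?A. g \<oplus>\<^bsub>?A\<^esub> f = \<zero>\<^bsub>?A\<^esub>" if "f \<in> carrier ?A" for f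
        using that by (intro bexI[of _ "\<lambda>x. - f x"]) (auto simp: add zero carr S_def)
    qed (auto simp: add zero)
  next
    show "Group.monoid ?A"
    proof (rule monoidI)
      show "f \<otimes>\<^bsub>?A\<^esub> g \<in> carrier ?A" if "f \<in> carrier ?A" "g \<in> carrier ?A" for f g
        using that by (rule mult_closed)
      show "\<one>\<^bsub>?A\<^esub> \<in> carrier ?A" by (auto simp: carr one S_def)
    next
      fix f g h assume fgh: "f \<in> carrier ?A" "g \<in> carrier ?A" "h \<in> carrier ?A"
      then have fin: "finite (S f)" "finite (S g)" "finite (S h)"
        and sub: "S f \<subseteq> carrier G" "S g \<subseteq> carrier G" "S h \<subseteq> carrier G" by (auto simp: carr)
      show "f \<otimes>\<^bsub>?A\<^esub> g \<otimes>\<^bsub>?A\<^esub> h = f \<otimes>\<^bsub>?A\<^esub> (g \<otimes>\<^bsub>?A\<^esub> h)"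
      proof
        fix x
        have "(f \<otimes>\<^bsub>?A\<^esub> g \<otimes>\<^bsub>?A\<^esub> h) x = (\<Sum>w\<in>P (S f) (S g). (f \<otimes>\<^bsub>?A\<^esub> g) w *
            (\<Sum>z\<in>S h. h z * (if w \<otimes> z = x then 1 else 0)))"
          by (subst mult[OF P[OF fin(1,2)] fin(3) SP order_refl])
            (simp add: sum_distrib_left mult.assoc)
        also have "\<dots> = (\<Sum>y\<in>S f. \<Sum>z\<in>S g. f y * g z *
            (\<Sum>w\<in>S h. h w * (if y \<otimes> z \<otimes> w = x then 1 else 0)))"
          by (rule mult_sum) (auto simp: fin P P_mem)
        also have "\<dots> = (\<Sum>y\<in>S f. f y * (\<Sum>z\<in>S g. \<Sum>w\<in>S h. g z * h w *
            (if y \<otimes> (z \<otimes> w) = x then 1 else 0)))"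
          unfolding sum_distrib_left mult.assoc using sub
          by (intro sum.cong refl) (auto simp: m_assoc subset_iff)
        also have "\<dots> = (\<Sum>y\<in>S f. f y * (\<Sum>v\<in>P (S g) (S h). (g \<otimes>\<^bsub>?A\<^esub> h) v *
            (if y \<otimes> v = x then 1 else 0)))"
        proof -
          have "(\<Sum>v\<in>P (S g) (S h). (g \<otimes>\<^bsub>?A\<^esub> h) v * (if y \<otimes> v = x then 1 else 0)) =
              (\<Sum>z\<in>S g. \<Sum>w\<in>S h. g z * h w * (if y \<otimes> (z \<otimes> w) = x then 1 else 0))" for y
            by (rule mult_sum) (auto simp: fin P P_mem)
          then show ?thesis by simp
        qed
        also have "\<dots> = (f \<otimes>\<^bsub>?A\<^esub> (g \<otimes>\<^bsub>?A\<^esub> h)) x"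
          by (subst mult[OF fin(1) P[OF fin(2,3)] order_refl SP])
            (simp add: sum_distrib_left mult.assoc)
        finally show "(f \<otimes>\<^bsub>?A\<^esub> g \<otimes>\<^bsub>?A\<^esub> h) x = (f \<otimes>\<^bsub>?A\<^esub> (g \<otimes>\<^bsub>?A\<^esub> h)) x" .
      qed
    next
      fix f assume f: "f \<in> carrier ?A"
      then have fin: "finite (S f)" and sub: "S f \<subseteq> carrier G" by (auto simp: carr)
      have S1: "S \<one>\<^bsub>?A\<^esub> \<subseteq> {\<one>}" by (auto simp: S_def one)
      have delta: "(\<Sum>z\<in>S f. f z * (if z = x then 1 else 0)) = f x" for x
      proof -
        have "(\<Sum>z\<in>S f. f z * (if z = x then 1 else 0)) = (\<Sum>z\<in>S f. if z = x then f z else 0)"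
          by (intro sum.cong) auto
        then show ?thesis using fin by (auto simp: S_def)
      qed
      show "\<one>\<^bsub>?A\<^esub> \<otimes>\<^bsub>?A\<^esub> f = f"
      proof
        fix x
        have "(\<one>\<^bsub>?A\<^esub> \<otimes>\<^bsub>?A\<^esub> f) x = (\<Sum>z\<in>S f. f z * (if \<one> \<otimes> z = x then 1 else 0))"
          by (subst mult[OF _ fin S1 order_refl]) (simp_all add: one)
        also have "\<dots> = (\<Sum>z\<in>S f. f z * (if z = x then 1 else 0))"
          using sub by (intro sum.cong refl) (auto simp: subset_iff)
        finally show "(\<one>\<^bsub>?A\<^esub> \<otimes>\<^bsub>?A\<^esub> f) x = f x" by (simp only: delta)
      qed
      show "f \<otimes>\<^bsub>?A\<^esub> \<one>\<^bsub>?A\<^esub> = f"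
      proof
        fix x
        have "(f \<otimes>\<^bsub>?A\<^esub> \<one>\<^bsub>?A\<^esub>) x = (\<Sum>z\<in>S f. f z * (if z \<otimes> \<one> = x then 1 else 0))"
          by (subst mult[OF fin _ order_refl S1]) (simp_all add: one)
        also have "\<dots> = (\<Sum>z\<in>S f. f z * (if z = x then 1 else 0))"
          using sub by (intro sum.cong refl) (auto simp: subset_iff)
        finally show "(f \<otimes>\<^bsub>?A\<^esub> \<one>\<^bsub>?A\<^esub>) x = f x" by (simp only: delta)
      qed
    qed
  next
    fix f g h assume "f \<in> carrier ?A" "g \<in> carrier ?A" "h \<in> carrier ?A"
    then have fin: "finite (S f)" "finite (S g)" "finite (S h)" by (auto simp: carr)
    show "(f \<oplus>\<^bsub>?A\<^esub> g) \<otimes>\<^bsub>?A\<^esub> h = f \<otimes>\<^bsub>?A\<^esub> h \<oplus>\<^bsub>?A\<^esub> g \<otimes>\<^bsub>?A\<^esub> h"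
    proof
      fix x
      have "((f \<oplus>\<^bsub>?A\<^esub> g) \<otimes>\<^bsub>?A\<^esub> h) x = (\<Sum>y\<in>S f \<union> S g. \<Sum>z\<in>S h. (f y + g y) * h z *
          (if y \<otimes> z = x then 1 else 0))"
        by (subst mult[OF _ fin(3) S_add order_refl]) (simp_all add: fin add)
      moreover have "(f \<otimes>\<^bsub>?A\<^esub> h) x = (\<Sum>y\<in>S f \<union> S g. \<Sum>z\<in>S h. f y * h z *
          (if y \<otimes> z = x then 1 else 0))"
        by (rule mult) (auto simp: fin)
      moreover have "(g \<otimes>\<^bsub>?A\<^esub> h) x = (\<Sum>y\<in>S f \<union> S g. \<Sum>z\<in>S h. g y * h z *
          (if y \<otimes> z = x then 1 else 0))"
        by (rule mult) (auto simp: fin)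
      ultimately show "((f \<oplus>\<^bsub>?A\<^esub> g) \<otimes>\<^bsub>?A\<^esub> h) x = (f \<otimes>\<^bsub>?A\<^esub> h \<oplus>\<^bsub>?A\<^esub> g \<otimes>\<^bsub>?A\<^esub> h) x"
        by (simp add: add distrib_right sum.distrib)
    qed
    show "h \<otimes>\<^bsub>?A\<^esub> (f \<oplus>\<^bsub>?A\<^esub> g) = h \<otimes>\<^bsub>?A\<^esub> f \<oplus>\<^bsub>?A\<^esub> h \<otimes>\<^bsub>?A\<^esub> g"
    proof
      fix x
      have "(h \<otimes>\<^bsub>?A\<^esub> (f \<oplus>\<^bsub>?A\<^esub> g)) x = (\<Sum>z\<in>S h. \<Sum>y\<in>S f \<union> S g. h z * (f y + g y) *
          (if z \<otimes> y = x then 1 else 0))"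
        by (subst mult[OF fin(3) _ order_refl S_add]) (simp_all add: fin add)
      moreover have "(h \<otimes>\<^bsub>?A\<^esub> f) x = (\<Sum>z\<in>S h. \<Sum>y\<in>S f \<union> S g. h z * f y *
          (if z \<otimes> y = x then 1 else 0))"
        by (rule mult) (auto simp: fin)
      moreover have "(h \<otimes>\<^bsub>?A\<^esub> g) x = (\<Sum>z\<in>S h. \<Sum>y\<in>S f \<union> S g. h z * g y *
          (if z \<otimes> y = x then 1 else 0))"
        by (rule mult) (auto simp: fin)
      ultimately show "(h \<otimes>\<^bsub>?A\<^esub> (f \<oplus>\<^bsub>?A\<^esub> g)) x = (h \<otimes>\<^bsub>?A\<^esub> f \<oplus>\<^bsub>?A\<^esub> h \<otimes>\<^bsub>?A\<^esub> g) x"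
        by (simp add: add distrib_left distrib_right sum.distrib)
    qed
  qed
qed

lemma (in monoid) module_complex_group_algebra:
  "module (ring_of_type_algebra :: complex ring) (complex_group_algebra G)"
proof -
  interpret A: ring "complex_group_algebra G" by (rule ring_complex_group_algebra)
  show ?thesis
  proof (rule moduleI)
    fix c :: complex and f assume "f \<in> carrier (complex_group_algebra G)"
    then show "c \<odot>\<^bsub>complex_group_algebra G\<^esub> f \<in> carrier (complex_group_algebra G)"
      by (auto simp: complex_group_algebra_def)
  qed (auto simp: A.abelian_group_axioms cring_from_type_algebra,
    auto simp: complex_group_algebra_def ring_of_type_algebra_def algebra_simps)
qed

lemma (in monoid) complex_group_algebra_smult_mult:
  assumes "f \<in> carrier (complex_group_algebra G)" "g \<in> carrier (complex_group_algebra G)"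
  shows "(c \<odot>\<^bsub>complex_group_algebra G\<^esub> f) \<otimes>\<^bsub>complex_group_algebra G\<^esub> g =
      c \<odot>\<^bsub>complex_group_algebra G\<^esub> (f \<otimes>\<^bsub>complex_group_algebra G\<^esub> g)"
    and "f \<otimes>\<^bsub>complex_group_algebra G\<^esub> (c \<odot>\<^bsub>complex_group_algebra G\<^esub> g) =
      c \<odot>\<^bsub>complex_group_algebra G\<^esub> (f \<otimes>\<^bsub>complex_group_algebra G\<^esub> g)"
  by (cases "c = 0"; force simp: complex_group_algebra_def sum_distrib_left mult_ac intro!: sum.cong)+

end

(*
The two algebras are distinguished by the number of distinct characters of noncommutative
representations by complex matrices of degree two, a number that depends only on the algebra.

For Z/2^m with m >= 3 there are at least three. For each of the three roots theta of
theta^3 = -2 theta, the upper unipotent matrix u(1) acts by a matrix of trace theta, and the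
representation factors through SL_2(Z/8); for theta = 0 its image is S_3.

For R = F_2[t]/(t^n) there are at most two. In such a representation u(1) and the Weyl element w
satisfy the relations of S_3 and act irreducibly, so each involution u(x) acts by one of
1, -1, S, -S, where S is the image of u(1). Conjugation by diag(1+t, 1/(1+t)) multiplies the
argument of u by 1 + t^2; comparing this with a factorization of the diagonal matrix into
unipotent and Weyl elements shows that u(t^2 y) acts trivially and that u(t) acts by a sign.
Since u(R) and w generate the group, this sign determines the character.
*)

theory Submission
  imports Defs
begin

section \<open>Complex matrices of degree two\<close>

datatype mat2 = Mat2 (m11: complex) (m12: complex) (m21: complex) (m22: complex)

instantiation mat2 :: ring_1
begin

definition "0 = Mat2 0 0 0 0"
definition "1 = Mat2 1 0 0 1"
definition "A + B = Mat2 (m11 A + m11 B) (m12 A + m12 B) (m21 A + m21 B) (m22 A + m22 B)"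
definition "A - B = Mat2 (m11 A - m11 B) (m12 A - m12 B) (m21 A - m21 B) (m22 A - m22 B)"
definition "- A = Mat2 (- m11 A) (- m12 A) (- m21 A) (- m22 A)"
definition "A * B = Mat2 (m11 A * m11 B + m12 A * m21 B) (m11 A * m12 B + m12 A * m22 B)
  (m21 A * m11 B + m22 A * m21 B) (m21 A * m12 B + m22 A * m22 B)"

instance
  by standard (auto simp: zero_mat2_def one_mat2_def plus_mat2_def minus_mat2_def
    uminus_mat2_def times_mat2_def algebra_simps)

end

lemmas mat2_defs = zero_mat2_def one_mat2_def plus_mat2_def minus_mat2_def
  uminus_mat2_def times_mat2_def

definition scalar_mat2 :: "complex \<Rightarrow> mat2" where
  "scalar_mat2 c = Mat2 c 0 0 c"

definition trace_mat2 :: "mat2 \<Rightarrow> complex" where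
  "trace_mat2 A = m11 A + m22 A"

definition det_mat2 :: "mat2 \<Rightarrow> complex" where
  "det_mat2 A = m11 A * m22 A - m12 A * m21 A"

lemma trace_mat2_simps [simp]:
  "trace_mat2 (A + B) = trace_mat2 A + trace_mat2 B"
  "trace_mat2 (- A) = - trace_mat2 A"
  "trace_mat2 (scalar_mat2 c * A) = c * trace_mat2 A"
  "trace_mat2 0 = 0" "trace_mat2 1 = 2"
  by (simp_all add: trace_mat2_def scalar_mat2_def mat2_defs algebra_simps)

lemma scalar_mat2_simps:
  "scalar_mat2 0 = 0" "scalar_mat2 1 = 1"
  "scalar_mat2 (a + b) = scalar_mat2 a + scalar_mat2 b"
  "scalar_mat2 (a * b) = scalar_mat2 a * scalar_mat2 b"
  "A * scalar_mat2 a = scalar_mat2 a * A"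
  by (simp_all add: scalar_mat2_def mat2_defs algebra_simps)

lemma det_mat2_mult: "det_mat2 (A * B) = det_mat2 A * det_mat2 B"
  by (simp add: det_mat2_def mat2_defs algebra_simps)


lemma scalar_mat2_uminus: "scalar_mat2 (- c) = - scalar_mat2 c"
  by (simp add: scalar_mat2_def mat2_defs)

lemma scalar_mat2_diff: "scalar_mat2 (a - b) = scalar_mat2 a - scalar_mat2 b"
  by (simp add: scalar_mat2_def mat2_defs)

lemma det_mat2_simps [simp]: "det_mat2 1 = 1" "det_mat2 (- A) = det_mat2 A"
  by (simp_all add: det_mat2_def mat2_defs)


section \<open>Three representations of the special linear group modulo 8\<close>

text \<open>The roots are 0 and the two square roots of -2. The product is nested to the right so
  that the equation can rewrite monomials in the form that \<open>algebra_simps\<close>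
  produces.\<close>

locale theta_rep =
  fixes \<theta> :: complex
  assumes theta: "\<theta> * (\<theta> * \<theta>) = - 2 * \<theta>"
begin

text \<open>\<open>matT\<close> has trace \<open>\<theta>\<close> and determinant -1.
  \<open>matS\<close> is an involution chosen so that \<open>matT * matS\<close> has trace -1 and
  determinant 1, hence order three. This mirrors (us)^3 = -1, for u with rows (1, 1), (0, 1) and s
  with rows (0, -1), (1, 0), when -1 acts trivially.\<close>

definition matT :: mat2 where "matT = Mat2 0 1 1 \<theta>"
definition matS :: mat2 where "matS = Mat2 1 0 (\<theta> - 1) (- 1)"
definition matT_pow :: "int \<Rightarrow> mat2" where "matT_pow n = matT ^ nat (n mod 8)"
definition factor :: "int \<Rightarrow> mat2" where
  "factor n = (if n mod 8 \<in> {1, 7} then 1 else scalar_mat2 (\<theta> * \<theta> + 1))"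

lemma matS_matS: "matS * matS = 1"
  by (simp add: matS_def mat2_defs)

text \<open>The cubic equation keeps the entries of degree at most two. The fourth power is the
  scalar \<open>\<theta> * \<theta> + 1\<close>, whose square is 1.\<close>

lemma matT_powers:
  "matT ^ 2 = Mat2 1 \<theta> \<theta> (\<theta> * \<theta> + 1)"
  "matT ^ 3 = Mat2 \<theta> (\<theta> * \<theta> + 1) (\<theta> * \<theta> + 1) 0"
  "matT ^ 4 = Mat2 (\<theta> * \<theta> + 1) 0 0 (\<theta> * \<theta> + 1)"
  "matT ^ 5 = Mat2 0 (\<theta> * \<theta> + 1) (\<theta> * \<theta> + 1) (- \<theta>)"
  "matT ^ 6 = Mat2 (\<theta> * \<theta> + 1) (- \<theta>) (- \<theta>) 1"
  "matT ^ 7 = Mat2 (- \<theta>) 1 1 0"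
  "matT ^ 8 = 1"
proof -
  have step: "matT ^ Suc n = Mat2 c d (a + \<theta> * c) (b + \<theta> * d)"
    if "matT ^ n = Mat2 a b c d" for n a b c d
    using that by (simp add: matT_def times_mat2_def)
  show 2: "matT ^ 2 = Mat2 1 \<theta> \<theta> (\<theta> * \<theta> + 1)"
    by (simp add: matT_def mat2_defs power2_eq_square)
  show 3: "matT ^ 3 = Mat2 \<theta> (\<theta> * \<theta> + 1) (\<theta> * \<theta> + 1) 0"
    using step[OF 2] theta by (simp add: algebra_simps)
  show 4: "matT ^ 4 = Mat2 (\<theta> * \<theta> + 1) 0 0 (\<theta> * \<theta> + 1)"
    using step[OF 3] theta by (simp add: algebra_simps)
  show 5: "matT ^ 5 = Mat2 0 (\<theta> * \<theta> + 1) (\<theta> * \<theta> + 1) (- \<theta>)"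
    using step[OF 4] theta by (simp add: algebra_simps)
  show 6: "matT ^ 6 = Mat2 (\<theta> * \<theta> + 1) (- \<theta>) (- \<theta>) 1"
    using step[OF 5] theta by (simp add: algebra_simps)
  show 7: "matT ^ 7 = Mat2 (- \<theta>) 1 1 0"
    using step[OF 6] theta by (simp add: algebra_simps)
  show "matT ^ 8 = 1"
    using step[OF 7] theta by (simp add: one_mat2_def algebra_simps)
qed

lemma matT_pow_cong: "m mod 8 = n mod 8 \<Longrightarrow> matT_pow m = matT_pow n"
  by (simp add: matT_pow_def)

lemma power_matT_mod: "matT ^ (n mod 8) = matT ^ n"
proof -
  have "matT ^ n = matT ^ (8 * (n div 8) + n mod 8)" by simp
  also have "\<dots> = matT ^ (n mod 8)"
    by (simp only: power_add power_mult matT_powers(7) power_one mult_1_left)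
  finally show ?thesis by simp
qed

lemma matT_pow_add: "matT_pow (m + n) = matT_pow m * matT_pow n"
proof -
  have "int (nat ((m + n) mod 8)) = int ((nat (m mod 8) + nat (n mod 8)) mod 8)"
    by (simp add: zmod_int mod_add_eq)
  then have "nat ((m + n) mod 8) = (nat (m mod 8) + nat (n mod 8)) mod 8"
    by (simp only: of_nat_eq_iff)
  then show ?thesis
    by (simp only: matT_pow_def power_add power_matT_mod)
qed

lemma mod_8_cases:
  fixes x :: int
  shows "x mod 8 \<in> {0, 1, 2, 3, 4, 5, 6, 7}"
  by (simp; presburger)

lemma matT_pow_values:
  "matT_pow 0 = 1" "matT_pow 1 = matT"
  using matT_powers by (simp_all add: matT_pow_def)

lemma matT_pow_mod: "matT_pow (n mod 8) = matT_pow n"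
  by (simp add: matT_pow_def)

lemma factor_commute: "A * factor x = factor x * A"
  by (simp add: factor_def scalar_mat2_simps(5))

text \<open>Modulo 8 the classes of 1 and -1 form a subgroup of index two in the odd residues, and
  the scalar attached to the other coset squares to 1.\<close>

lemma factor_mult:
  assumes "odd x" "odd y"
  shows "factor (x * y) = factor x * factor y"
proof -
  have sq: "scalar_mat2 (\<theta> * \<theta> + 1) * scalar_mat2 (\<theta> * \<theta> + 1) = 1"
    using theta by (simp add: scalar_mat2_def mat2_defs algebra_simps)
  have "x mod 8 \<in> {1, 3, 5, 7}" "y mod 8 \<in> {1, 3, 5, 7}"
    using assms by (simp; presburger)+
  moreover have "(x * y) mod 8 = ((x mod 8) * (y mod 8)) mod 8"
    by (simp add: mod_mult_eq)
  ultimately show ?thesis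
    by (elim insertE emptyE; simp add: factor_def sq)
qed

text \<open>
  Let \<open>u(x)\<close> have rows \<open>(1, x)\<close>, \<open>(0, 1)\<close> and let \<open>s\<close> have rows \<open>(0, - 1)\<close>, \<open>(1, 0)\<close>. Odd squares are
  1 modulo 8, so a matrix of determinant 1 modulo 8 is congruent to \<open>c u(ac) s u(dc)\<close> if \<open>c\<close> is odd
  and to \<open>- a s u(- ac) s u(ab)\<close> if \<open>c\<close> is even. The map below sends \<open>u(1)\<close> to \<open>matT\<close>, \<open>s\<close> to
  \<open>matS\<close> and an odd scalar \<open>n\<close> to \<open>factor n\<close>, where \<open>factor (- n) = factor n\<close>.
\<close>

fun rho :: "int \<times> int \<times> int \<times> int \<Rightarrow> mat2" where
  "rho (a, b, c, d) = (if odd c then factor c * matT_pow (a * c) * matS * matT_pow (d * c)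
     else factor a * matS * matT_pow (- (a * c)) * matS * matT_pow (a * b))"

lemma even_of_cong_8: "[x = y] (mod 8) \<Longrightarrow> even x = even (y::int)"
  unfolding cong_def by presburger

lemma rho_cong:
  assumes "[a = a'] (mod 8)" "[b = b'] (mod 8)" "[c = c'] (mod 8)" "[d = d'] (mod 8)"
  shows "rho (a, b, c, d) = rho (a', b', c', d')"
proof -
  have pow: "matT_pow x = matT_pow y" if "[x = y] (mod 8)" for x y
    using that by (simp only: matT_pow_def cong_def)
  have fac: "factor x = factor y" if "[x = y] (mod 8)" for x y
    using that by (simp only: factor_def cong_def)
  have "factor c = factor c'" "factor a = factor a'"
    by (intro fac assms)+
  moreover have "matT_pow (a * c) = matT_pow (a' * c')" "matT_pow (d * c) = matT_pow (d' * c')"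
    "matT_pow (a * b) = matT_pow (a' * b')"
    by (intro pow cong_mult assms)+
  moreover have "matT_pow (- (a * c)) = matT_pow (- (a' * c'))"
    by (intro pow cong_uminus cong_mult assms)
  ultimately show ?thesis
    unfolding rho.simps even_of_cong_8[OF assms(3)] by (simp only:)
qed

section \<open>Right multiplication by unipotents, scalars and the Weyl element\<close>

lemma odd_square_cong:
  fixes x :: int
  assumes "odd x"
  shows "[x * x = 1] (mod 8)"
proof -
  have "x mod 8 \<in> {1, 3, 5, 7}" using assms by (simp; presburger)
  moreover have "(x * x) mod 8 = ((x mod 8) * (x mod 8)) mod 8"
    by (simp add: mod_mult_eq)
  ultimately show ?thesis unfolding cong_def by auto
qed

lemma odd_square_mult_cong:
  fixes x y :: int
  assumes "odd x"
  shows "[x * (x * y) = y] (mod 8)"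
  using cong_mult[OF odd_square_cong[OF assms] cong_refl, of y] by (simp add: mult.assoc)

text \<open>Only the last exponent changes, by \<open>k\<close> times an odd square, which is
  \<open>k\<close> modulo 8.\<close>

lemma rho_mult_upper:
  assumes "[a * d - b * c = 1] (mod 8)"
  shows "rho (a, b + k * a, c, d + k * c) = rho (a, b, c, d) * matT_pow k"
proof (cases "odd c")
  case True
  have "[d * c + c * (c * k) = d * c + k] (mod 8)"
    by (intro cong_add cong_refl odd_square_mult_cong True)
  then have "matT_pow ((d + k * c) * c) = matT_pow (d * c + k)"
    by (intro matT_pow_cong) (simp add: cong_def algebra_simps)
  with True show ?thesis by (simp add: matT_pow_add mult.assoc)
next
  case False
  then have "odd a" using even_of_cong_8[OF assms] by auto
  then have "[a * b + a * (a * k) = a * b + k] (mod 8)"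
    by (intro cong_add cong_refl odd_square_mult_cong)
  then have "matT_pow (a * (b + k * a)) = matT_pow (a * b + k)"
    by (intro matT_pow_cong) (simp add: cong_def algebra_simps)
  with False show ?thesis by (simp add: matT_pow_add mult.assoc)
qed

text \<open>Every exponent is, up to sign, a product of two entries and picks up
  \<open>z * z\<close>, which is 1 modulo 8; only the leading factor changes.\<close>

lemma rho_scale:
  assumes "odd z" "odd a \<or> odd c"
  shows "rho (z * a, z * b, z * c, z * d) = factor z * rho (a, b, c, d)"
proof -
  have *: "matT_pow ((z * x) * (z * y)) = matT_pow (x * y)"
    "matT_pow (- ((z * x) * (z * y))) = matT_pow (- (x * y))" for x y
    using odd_square_mult_cong[OF assms(1), of "x * y"] odd_square_mult_cong[OF assms(1), of "- (x * y)"]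
    by (auto intro!: matT_pow_cong simp: cong_def algebra_simps)
  show ?thesis using assms
    by (cases "odd c") (simp_all add: * factor_mult, simp_all add: mult.assoc)
qed

lemma theta_cases: "\<theta> = 0 \<or> \<theta> * \<theta> = - 2"
  using theta by (metis mult.commute mult_cancel_right)

text \<open>The argument of \<open>rho\<close> is u(x) s u(y) s. These 64 cases, each checked for
  \<open>\<theta> = 0\<close> and for \<open>\<theta> * \<theta> = - 2\<close>, are the finite
  verification on which multiplicativity rests.\<close>

lemma rho_mult_weyl_table:
  assumes "x \<in> {0, 1, 2, 3, 4, 5, 6, 7}" "y \<in> {0, 1, 2, 3, 4, 5, 6, 7}"
  shows "rho (x * y - 1, - x, y, - 1) = matT_pow x * matS * matT_pow y * matS"
  using assms
  by (elim insertE emptyE; hypsubst; simp add: matT_pow_def factor_def;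
      (simp only: matT_powers scalar_mat2_def matS_def one_mat2_def)?; (simp only: matT_def)?;
      (insert theta_cases, elim disjE; simp add: times_mat2_def algebra_simps))

lemma rho_mult_weyl_unit:
  "rho (a * d - 1, - a, d, - 1) = rho (a, a * d - 1, 1, d) * matS"
proof -
  have "rho (a * d - 1, - a, d, - 1) =
      rho ((a mod 8) * (d mod 8) - 1, - (a mod 8), d mod 8, - 1)"
    by (intro rho_cong cong_diff cong_mult cong_uminus cong_refl; simp only: cong_def mod_mod_trivial)
  also have "\<dots> = matT_pow (a mod 8) * matS * matT_pow (d mod 8) * matS"
    by (intro rho_mult_weyl_table mod_8_cases)
  finally show ?thesis by (simp add: matT_pow_mod factor_def)
qed

text \<open>Reduces a congruence to a polynomial identity: in the applications \<open>p\<close> is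
  an odd square, \<open>q\<close> is a determinant, and \<open>A\<close>, \<open>B\<close> are the
  cofactors of \<open>p - 1\<close> and \<open>q - 1\<close>.\<close>

lemma cong_8_combination:
  fixes x y p q A B :: int
  assumes "[p = 1] (mod 8)" "[q = 1] (mod 8)" "x - y = (p - 1) * A + (q - 1) * B"
  shows "[x = y] (mod 8)"
  using assms unfolding cong_iff_dvd_diff by simp

lemma odd_column:
  fixes a b c d :: int
  assumes "[a * d - b * c = 1] (mod 8)"
  shows "odd a \<or> odd c"
  using even_of_cong_8[OF assms] by auto

lemma rho_mult_weyl_odd:
  assumes det: "[a * d - b * c = 1] (mod 8)" and "odd c"
  shows "rho (b, - a, d, - c) = rho (a, b, c, d) * matS"
proof -
  \<comment> \<open>Modulo 8 the odd \<open>c\<close> is its own inverse, so the matrix is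
    \<open>c\<close> times one with lower left entry 1, whose upper right entry is forced by the
    determinant.\<close>
  define a' d' where "a' = c * a" and "d' = c * d"
  note sq = odd_square_cong[OF \<open>odd c\<close>]
  note comb = cong_8_combination[OF sq det]
  have cong: "[a = c * a'] (mod 8)" "[c = c * 1] (mod 8)" "[d = c * d'] (mod 8)"
      "[b = c * (a' * d' - 1)] (mod 8)" "[- a = c * - a'] (mod 8)" "[- c = c * - 1] (mod 8)"
    unfolding a'_def d'_def
    by (rule comb[of _ _ "- a" 0] comb[of _ _ 0 0] comb[of _ _ "- d" 0]
        comb[of _ _ "- a * d * c - b" "- c"] comb[of _ _ a 0]; simp add: algebra_simps)+
  have "rho (a, b, c, d) = rho (c * a', c * (a' * d' - 1), c * 1, c * d')"
    by (intro rho_cong cong)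
  moreover have "\<dots> = factor c * rho (a', a' * d' - 1, 1, d')"
    by (intro rho_scale \<open>odd c\<close>) simp
  moreover have "rho (b, - a, d, - c) = rho (c * (a' * d' - 1), c * - a', c * d', c * - 1)"
    by (intro rho_cong cong)
  moreover have "\<dots> = factor c * rho (a' * d' - 1, - a', d', - 1)"
    by (intro rho_scale \<open>odd c\<close>) auto
  ultimately show ?thesis
    by (simp only: rho_mult_weyl_unit mult.assoc)
qed

lemma rho_uminus:
  assumes "[a * d - b * c = 1] (mod 8)"
  shows "rho (- a, - b, - c, - d) = rho (a, b, c, d)"
  using rho_scale[of "- 1" a c b d] odd_column[OF assms]
  by (simp add: factor_def del: rho.simps)

text \<open>For even \<open>c\<close> the entry \<open>d\<close> is odd, so the odd case applies to
  the product with s. Multiplying by s once more gives the negative matrix, on which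
  \<open>rho\<close> has the same value.\<close>

lemma rho_mult_weyl:
  assumes det: "[a * d - b * c = 1] (mod 8)"
  shows "rho (b, - a, d, - c) = rho (a, b, c, d) * matS"
proof (cases "odd c")
  case True
  then show ?thesis by (intro rho_mult_weyl_odd det)
next
  case False
  then have "odd d" using even_of_cong_8[OF det] by auto
  moreover have "[b * - c - - a * d = 1] (mod 8)"
    using det by (simp add: algebra_simps)
  ultimately have "rho (- a, - b, - c, - d) = rho (b, - a, d, - c) * matS"
    by (intro rho_mult_weyl_odd)
  then have "rho (a, b, c, d) * matS = rho (b, - a, d, - c) * (matS * matS)"
    by (simp only: rho_uminus[OF det] mult.assoc)
  then show ?thesis by (simp only: matS_matS mult_1_right)
qed

section \<open>Multiplicativity\<close>

lemma rho_mult_word: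
  assumes "[a * d - b * c = 1] (mod 8)"
  shows "rho (b + x * a, - a + y * (b + x * a), d + x * c, - c + y * (d + x * c)) =
    rho (a, b, c, d) * matT_pow x * matS * matT_pow y"
proof -
  have "[a * (d + x * c) - (b + x * a) * c = 1] (mod 8)"
    "[(b + x * a) * - c - - a * (d + x * c) = 1] (mod 8)"
    using assms by (simp_all add: algebra_simps)
  then show ?thesis
    using assms by (simp only: rho_mult_upper rho_mult_weyl)
qed

text \<open>The second factor is replaced by its normal form, a scalar times a word in unipotents
  and s, and the word is absorbed into the first factor letter by letter.\<close>

lemma rho_mult:
  assumes det: "[a * d - b * c = 1] (mod 8)" and det': "[a' * d' - b' * c' = 1] (mod 8)"
  shows "rho (a * a' + b * c', a * b' + b * d', c * a' + d * c', c * b' + d * d') =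
    rho (a, b, c, d) * rho (a', b', c', d')"
proof (cases "odd c'")
  case True
  note comb = cong_8_combination[OF odd_square_cong[OF True] det']
  define x y where "x = a' * c'" and "y = d' * c'"
  \<comment> \<open>Stated for arbitrary \<open>a\<close> and \<open>b\<close> because it serves
    both rows of the product.\<close>
  have cong: "[a * a' + b * c' = c' * (b + x * a)] (mod 8)"
    "[a * b' + b * d' = c' * (- a + y * (b + x * a))] (mod 8)" for a b
    unfolding x_def y_def
    by (rule comb[of _ _ "- a * a'" 0],
        simp add: algebra_simps,
        rule comb[of _ _ "- b * d' - a * c' - a * b' * (c' * c' + 1)" "- a * c' * c' * c'"],
        simp add: algebra_simps)
  have "[(b + x * a) * (- c + y * (d + x * c)) - (- a + y * (b + x * a)) * (d + x * c) = 1] (mod 8)"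
    using det by (simp add: algebra_simps)
  then have "odd (b + x * a) \<or> odd (d + x * c)" by (rule odd_column)
  have "rho (a * a' + b * c', a * b' + b * d', c * a' + d * c', c * b' + d * d') =
      rho (c' * (b + x * a), c' * (- a + y * (b + x * a)),
        c' * (d + x * c), c' * (- c + y * (d + x * c)))"
    by (intro rho_cong cong)
  also have "\<dots> = factor c' * (rho (a, b, c, d) * matT_pow x * matS * matT_pow y)"
    unfolding rho_mult_word[OF det, symmetric] by (intro rho_scale True) fact
  also have "\<dots> = rho (a, b, c, d) * (factor c' * matT_pow x * matS * matT_pow y)"
    by (simp only: mult.assoc[symmetric] factor_commute)
  also have "\<dots> = rho (a, b, c, d) * rho (a', b', c', d')"
    using True by (simp add: x_def y_def del: rho.simps) (simp only: rho.simps if_True not_False_eq_True)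
  finally show ?thesis .
next
  case False
  then have "odd a'" using odd_column[OF det'] by blast
  note comb = cong_8_combination[OF odd_square_cong[OF \<open>odd a'\<close>] det']
  define x y where "x = - (a' * c')" and "y = a' * b'"
  have odd_uminus: "odd (- a')" using \<open>odd a'\<close> by simp
  \<comment> \<open>The normal form now begins with s, which turns the first factor into
    \<open>(b, - a, d, - c)\<close>; what remains is u(x) s u(y) with the scalar
    \<open>- a'\<close>.\<close>
  have det_s: "[b * - c - - a * d = 1] (mod 8)" using det by (simp add: algebra_simps)
  have cong: "[a * a' + b * c' = - a' * (- a + x * b)] (mod 8)"
    "[a * b' + b * d' = - a' * (- b + y * (- a + x * b))] (mod 8)" for a b
    unfolding x_def y_def
    by (rule comb[of _ _ "- b * c'" 0],
        simp add: algebra_simps,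
        rule comb[of _ _ "- a * b' + b * a' - b * d' * (a' * a' + 1)" "b * a' * a' * a'"],
        simp add: algebra_simps)
  have "[(- a + x * b) * (- d + y * (- c + x * d)) - (- b + y * (- a + x * b)) * (- c + x * d) = 1] (mod 8)"
    using det by (simp add: algebra_simps)
  then have "odd (- a + x * b) \<or> odd (- c + x * d)" by (rule odd_column)
  have "rho (a * a' + b * c', a * b' + b * d', c * a' + d * c', c * b' + d * d') =
      rho (- a' * (- a + x * b), - a' * (- b + y * (- a + x * b)),
        - a' * (- c + x * d), - a' * (- d + y * (- c + x * d)))"
    by (intro rho_cong cong)
  also have "\<dots> = factor (- a') * (rho (b, - a, d, - c) * matT_pow x * matS * matT_pow y)"
    unfolding rho_mult_word[OF det_s, symmetric]
    by (intro rho_scale) (fact odd_uminus, fact)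
  also have "factor (- a') = factor a'"
    using factor_mult[of "- 1" a'] \<open>odd a'\<close> by (simp add: factor_def[of "- 1"])
  also have "factor a' * (rho (b, - a, d, - c) * matT_pow x * matS * matT_pow y) =
      rho (a, b, c, d) * (factor a' * matS * matT_pow x * matS * matT_pow y)"
    by (simp only: rho_mult_weyl[OF det] mult.assoc[symmetric] factor_commute)
  also have "\<dots> = rho (a, b, c, d) * rho (a', b', c', d')"
    using False by (simp only: rho.simps if_False x_def y_def not_True_eq_False)
  finally show ?thesis .
qed

end

section \<open>Special linear groups over truncated polynomial rings of characteristic two\<close>

text \<open>An abstraction of F_2[t]/(t^n) that avoids polynomials. The last condition says that
  modulo \<open>t\<close> there are no classes besides those of 0 and 1.\<close>

locale char2_truncated = cring R for R (structure) +
  fixes t :: 'a and n :: nat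
  assumes char2: "\<one> \<oplus> \<one> = \<zero>"
    and t_closed [simp]: "t \<in> carrier R"
    and t_nilpotent: "t [^] n = \<zero>"
    and decomposition: "x \<in> carrier R \<Longrightarrow> \<exists>y\<in>carrier R. x = t \<otimes> y \<or> x = \<one> \<oplus> t \<otimes> y"
begin

lemma add_self [simp]: "x \<in> carrier R \<Longrightarrow> x \<oplus> x = \<zero>"
  using r_distr[of \<one> \<one> x] by (simp add: char2)

lemma add_self_left [simp]: "x \<in> carrier R \<Longrightarrow> y \<in> carrier R \<Longrightarrow> x \<oplus> (x \<oplus> y) = y"
  by (simp add: a_assoc[symmetric])

lemma uminus_self [simp]: "x \<in> carrier R \<Longrightarrow> \<ominus> x = x"
  by (simp add: minus_equality)

lemma minus_is_add [simp]: "x \<in> carrier R \<Longrightarrow> y \<in> carrier R \<Longrightarrow> x \<ominus> y = x \<oplus> y"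
  by (simp add: minus_eq)

lemma eq_add_swap:
  "x \<oplus> y = z \<Longrightarrow> x \<in> carrier R \<Longrightarrow> y \<in> carrier R \<Longrightarrow> y = x \<oplus> z"
  by auto

text \<open>In characteristic two 1 + z is 1 - z, so a partial sum of the geometric series serves as
  \<open>y\<close>. For nilpotent \<open>z\<close> this inverts 1 + z.\<close>

lemma geometric_sum:
  assumes "z \<in> carrier R"
  shows "\<exists>y\<in>carrier R. (\<one> \<oplus> z) \<otimes> y = \<one> \<oplus> z [^] (k::nat)"
proof (induction k)
  case 0
  then show ?case using assms by (intro bexI[of _ \<zero>]) (simp_all add: char2)
next
  case (Suc k)
  then obtain y where y: "y \<in> carrier R" "(\<one> \<oplus> z) \<otimes> y = \<one> \<oplus> z [^] k" by blast
  have "(\<one> \<oplus> z) \<otimes> (y \<oplus> z [^] k) = (\<one> \<oplus> z) \<otimes> y \<oplus> (z [^] k \<oplus> z [^] k \<otimes> z)"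
    using assms y(1) by (simp add: r_distr l_distr m_comm)
  also have "\<dots> = \<one> \<oplus> z [^] Suc k"
    using assms by (simp add: y(2) a_assoc)
  finally show ?case using assms y(1) by blast
qed

lemma one_add_t_unit: "y \<in> carrier R \<Longrightarrow> \<one> \<oplus> t \<otimes> y \<in> Units R"
proof -
  assume y: "y \<in> carrier R"
  have "(t \<otimes> y) [^] n = \<zero>" using y by (simp add: nat_pow_distrib t_nilpotent)
  then obtain z where "z \<in> carrier R" "(\<one> \<oplus> t \<otimes> y) \<otimes> z = \<one>"
    using geometric_sum[of "t \<otimes> y" n] y by auto
  then show ?thesis using y by (auto simp: Units_def m_comm)
qed

section \<open>Generators and relations\<close>

definition upper :: "'a \<Rightarrow> 'a \<times> 'a \<times> 'a \<times> 'a" where "upper x = (\<one>, x, \<zero>, \<one>)"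
text \<open>The determinant -1 equals 1 in characteristic two.\<close>

definition weyl :: "'a \<times> 'a \<times> 'a \<times> 'a" where "weyl = (\<zero>, \<one>, \<one>, \<zero>)"
definition diag :: "'a \<Rightarrow> 'a \<Rightarrow> 'a \<times> 'a \<times> 'a \<times> 'a" where "diag a b = (a, \<zero>, \<zero>, b)"

lemma SL2_mult: "(a, b, c, d) \<otimes>\<^bsub>SL2 R\<^esub> (a', b', c', d') =
    (a \<otimes> a' \<oplus> b \<otimes> c', a \<otimes> b' \<oplus> b \<otimes> d', c \<otimes> a' \<oplus> d \<otimes> c', c \<otimes> b' \<oplus> d \<otimes> d')"
  by (simp add: SL2_def)

lemma SL2_one: "\<one>\<^bsub>SL2 R\<^esub> = (\<one>, \<zero>, \<zero>, \<one>)"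
  by (simp add: SL2_def)

lemma SL2_carrier: "(a, b, c, d) \<in> carrier (SL2 R) \<longleftrightarrow> a \<in> carrier R \<and> b \<in> carrier R \<and>
    c \<in> carrier R \<and> d \<in> carrier R \<and> a \<otimes> d \<oplus> b \<otimes> c = \<one>"
  by (auto simp: SL2_def)

sublocale SL2: group "SL2 R" by (rule group_SL2)

lemma upper_closed [simp]: "x \<in> carrier R \<Longrightarrow> upper x \<in> carrier (SL2 R)"
  and weyl_closed [simp]: "weyl \<in> carrier (SL2 R)"
  and diag_closed: "a \<in> carrier R \<Longrightarrow> b \<in> carrier R \<Longrightarrow> a \<otimes> b = \<one> \<Longrightarrow> diag a b \<in> carrier (SL2 R)"
  by (simp_all add: SL2_carrier upper_def weyl_def diag_def)

lemma upper_zero: "upper \<zero> = \<one>\<^bsub>SL2 R\<^esub>"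
  by (simp add: upper_def SL2_one)

lemma upper_mult: "x \<in> carrier R \<Longrightarrow> y \<in> carrier R \<Longrightarrow> upper x \<otimes>\<^bsub>SL2 R\<^esub> upper y = upper (x \<oplus> y)"
  by (simp add: upper_def SL2_mult a_comm)

lemma weyl_weyl: "weyl \<otimes>\<^bsub>SL2 R\<^esub> weyl = \<one>\<^bsub>SL2 R\<^esub>"
  by (simp add: weyl_def SL2_mult SL2_one)

text \<open>Together with the two involutions this gives the defining relations of S_3, which is
  SL_2(F_2).\<close>

lemma upper_weyl_cube:
  "upper \<one> \<otimes>\<^bsub>SL2 R\<^esub> (weyl \<otimes>\<^bsub>SL2 R\<^esub> (upper \<one> \<otimes>\<^bsub>SL2 R\<^esub> (weyl \<otimes>\<^bsub>SL2 R\<^esub> (upper \<one> \<otimes>\<^bsub>SL2 R\<^esub> weyl)))) =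
    \<one>\<^bsub>SL2 R\<^esub>"
  by (simp add: upper_def weyl_def SL2_mult SL2_one char2)

lemma diag_upper:
  assumes "a \<in> carrier R" "b \<in> carrier R" "x \<in> carrier R" "a \<otimes> b = \<one>"
  shows "diag a b \<otimes>\<^bsub>SL2 R\<^esub> upper x = upper (a \<otimes> a \<otimes> x) \<otimes>\<^bsub>SL2 R\<^esub> diag a b"
proof -
  have "a \<otimes> a \<otimes> x \<otimes> b = a \<otimes> x \<otimes> (a \<otimes> b)" using assms(1-3) by (simp add: m_ac)
  then show ?thesis using assms by (simp add: diag_def upper_def SL2_mult)
qed

text \<open>As w u(x) w is the lower unipotent l(x), the word is l(b) u(t) l(1) u(tb): u(t) l(1) has
  upper left entry 1 + t, then l(b) clears the lower left entry and u(tb) the upper right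
  one.\<close>

lemma diag_factorization:
  assumes "b \<in> carrier R" "(\<one> \<oplus> t) \<otimes> b = \<one>"
  shows "diag (\<one> \<oplus> t) b =
    weyl \<otimes>\<^bsub>SL2 R\<^esub> (upper b \<otimes>\<^bsub>SL2 R\<^esub> (weyl \<otimes>\<^bsub>SL2 R\<^esub> (upper t \<otimes>\<^bsub>SL2 R\<^esub>
      (weyl \<otimes>\<^bsub>SL2 R\<^esub> (upper \<one> \<otimes>\<^bsub>SL2 R\<^esub> (weyl \<otimes>\<^bsub>SL2 R\<^esub> upper (t \<otimes> b)))))))"
proof -
  have tb: "t \<otimes> b = \<one> \<oplus> b"
    using assms eq_add_swap[of b "t \<otimes> b" \<one>] by (auto simp: l_distr a_comm)
  moreover have "b \<otimes> t = \<one> \<oplus> b"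
    using assms(1) tb by (simp add: m_comm)
  ultimately show ?thesis
    using assms(1) by (simp add: diag_def upper_def weyl_def SL2_mult l_distr r_distr a_ac)
qed

section \<open>Generation by unipotents and the Weyl element\<close>

lemma SL2_unit_factorization:
  assumes "(a, b, c, d) \<in> carrier (SL2 R)" "c \<in> Units R"
  shows "\<exists>p\<in>carrier R. \<exists>q\<in>carrier R. (a, b, c, d) =
    upper p \<otimes>\<^bsub>SL2 R\<^esub> (weyl \<otimes>\<^bsub>SL2 R\<^esub> (upper c \<otimes>\<^bsub>SL2 R\<^esub> (weyl \<otimes>\<^bsub>SL2 R\<^esub> upper q)))"
proof -
  obtain e where e: "e \<in> carrier R" "e \<otimes> c = \<one>" "c \<otimes> e = \<one>"
    using assms(2) by (auto simp: Units_def)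
  have R: "a \<in> carrier R" "b \<in> carrier R" "c \<in> carrier R" "d \<in> carrier R"
    and det: "a \<otimes> d \<oplus> b \<otimes> c = \<one>" using assms(1) by (auto simp: SL2_carrier)
  \<comment> \<open>These solve a = 1 + pc and d = 1 + cq; the determinant then yields the entry
    \<open>b\<close>.\<close>
  define p q where "p = (a \<oplus> \<one>) \<otimes> e" and "q = e \<otimes> (d \<oplus> \<one>)"
  have pq: "p \<in> carrier R" "q \<in> carrier R" using R e by (simp_all add: p_def q_def)
  have "p \<otimes> c = a \<oplus> \<one>" "c \<otimes> q = d \<oplus> \<one>"
    using R e by (simp_all add: p_def q_def m_assoc) (simp add: m_assoc[symmetric])
  moreover have "q \<oplus> p \<otimes> d = (a \<otimes> d \<oplus> \<one>) \<otimes> e"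
    using R e(1) by (simp add: p_def q_def l_distr r_distr m_ac a_ac)
  moreover have "a \<otimes> d \<oplus> \<one> = b \<otimes> c"
    using R det by (simp add: det[symmetric])
  ultimately have "q \<oplus> p \<otimes> d = b"
    using R e by (simp add: m_assoc)
  with pq R \<open>p \<otimes> c = a \<oplus> \<one>\<close> \<open>c \<otimes> q = d \<oplus> \<one>\<close> have "(a, b, c, d) =
      upper p \<otimes>\<^bsub>SL2 R\<^esub> (weyl \<otimes>\<^bsub>SL2 R\<^esub> (upper c \<otimes>\<^bsub>SL2 R\<^esub> (weyl \<otimes>\<^bsub>SL2 R\<^esub> upper q)))"
    by (simp add: upper_def weyl_def SL2_mult SL2_one a_ac)
  with pq show ?thesis by blast
qed

text \<open>Otherwise both entries are multiples of \<open>t\<close>, and the determinant 1 would be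
  nilpotent.\<close>

lemma column_unit:
  assumes "(a, b, c, d) \<in> carrier (SL2 R)"
  shows "a \<in> Units R \<or> c \<in> Units R"
proof (rule ccontr)
  assume not: "\<not> ?thesis"
  have R: "a \<in> carrier R" "b \<in> carrier R" "c \<in> carrier R" "d \<in> carrier R"
    and det: "a \<otimes> d \<oplus> b \<otimes> c = \<one>" using assms by (auto simp: SL2_carrier)
  obtain y z where yz: "y \<in> carrier R" "z \<in> carrier R" "a = t \<otimes> y" "c = t \<otimes> z"
    using decomposition[OF R(1)] decomposition[OF R(3)] one_add_t_unit not by metis
  define v where "v = y \<otimes> d \<oplus> z \<otimes> b"
  have "t \<otimes> v = \<one>" and v: "v \<in> carrier R"
    using yz R det by (simp_all add: v_def r_distr m_assoc m_comm[of b])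
  then have "\<one> = (t \<otimes> v) [^] n" by simp
  also have "\<dots> = \<zero>" using v by (simp add: nat_pow_distrib t_nilpotent)
  \<comment> \<open>Now 1 = 0, so the ring is zero and even there \<open>c\<close> is a
    unit.\<close>
  finally have "c = \<one>" using R(3) by (metis l_null l_one)
  then show False using not by simp
qed

text \<open>The unipotents and the Weyl element generate the group: if the lower left entry is not a
  unit, multiplication by \<open>weyl\<close> swaps the rows and moves a unit there.\<close>

lemma SL2_induct [consumes 1, case_names one upper weyl]:
  assumes g: "g \<in> carrier (SL2 R)" and one: "P \<one>\<^bsub>SL2 R\<^esub>"
    and up: "\<And>x g. x \<in> carrier R \<Longrightarrow> g \<in> carrier (SL2 R) \<Longrightarrow> P g \<Longrightarrow> P (upper x \<otimes>\<^bsub>SL2 R\<^esub> g)"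
    and we: "\<And>g. g \<in> carrier (SL2 R) \<Longrightarrow> P g \<Longrightarrow> P (weyl \<otimes>\<^bsub>SL2 R\<^esub> g)"
  shows "P g"
proof -
  have unit: "P (a, b, c, d)" if "(a, b, c, d) \<in> carrier (SL2 R)" "c \<in> Units R" for a b c d
  proof -
    have "c \<in> carrier R" using that by (simp add: SL2_carrier)
    moreover have "P (upper q)" if "q \<in> carrier R" for q
      using up[OF that SL2.one_closed one] that by simp
    ultimately show ?thesis using SL2_unit_factorization[OF that] by (auto intro!: up we)
  qed
  obtain a b c d where abcd: "g = (a, b, c, d)" by (cases g)
  show ?thesis
  proof (cases "c \<in> Units R")
    case True
    then show ?thesis using g unit by (simp add: abcd)
  next
    case False
    then have "a \<in> Units R" using column_unit g abcd by blast
    moreover have "weyl \<otimes>\<^bsub>SL2 R\<^esub> g = (c, d, a, b)"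
      using g by (simp add: abcd weyl_def SL2_mult SL2_carrier)
    moreover have "weyl \<otimes>\<^bsub>SL2 R\<^esub> g \<in> carrier (SL2 R)" using g by simp
    ultimately have "P (weyl \<otimes>\<^bsub>SL2 R\<^esub> (weyl \<otimes>\<^bsub>SL2 R\<^esub> g))"
      using unit we by metis
    then show ?thesis
      using g by (simp add: SL2.m_assoc[symmetric] weyl_weyl)
  qed
qed

end


section \<open>Noncommutative two-dimensional representations\<close>

text \<open>For a finite group this is irreducibility in degree two, expressed without invariant
  subspaces.\<close>

definition noncommutative_rep :: "('g, 'm) monoid_scheme \<Rightarrow> ('g \<Rightarrow> mat2) \<Rightarrow> bool" where
  "noncommutative_rep G \<rho> \<longleftrightarrow> \<rho> \<one>\<^bsub>G\<^esub> = 1 \<and>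
    (\<forall>x\<in>carrier G. \<forall>y\<in>carrier G. \<rho> (x \<otimes>\<^bsub>G\<^esub> y) = \<rho> x * \<rho> y) \<and>
    (\<exists>x\<in>carrier G. \<exists>y\<in>carrier G. \<rho> x * \<rho> y \<noteq> \<rho> y * \<rho> x)"

section \<open>Matrices of order two and three\<close>

lemma cayley_hamilton_mat2:
  "A * A = scalar_mat2 (trace_mat2 A) * A - scalar_mat2 (det_mat2 A)"
  by (simp add: trace_mat2_def det_mat2_def scalar_mat2_def mat2_defs algebra_simps)

text \<open>The off-diagonal entries of \<open>A * A\<close> are those of \<open>A\<close> times the
  trace. So the trace vanishes or \<open>A\<close> is diagonal with entries 1 or -1, which then
  agree.\<close>

lemma involution_mat2_cases:
  assumes "A * A = 1"
  shows "A = 1 \<or> A = - 1 \<or> trace_mat2 A = 0 \<and> det_mat2 A = - 1"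
proof -
  obtain a b c d where A: "A = Mat2 a b c d" by (cases A)
  have eq: "a * a + b * c = 1" "b * (a + d) = 0" "c * (a + d) = 0" "d * d + b * c = 1"
    using assms by (simp_all add: A mat2_defs algebra_simps)
  show ?thesis
  proof (cases "a + d = 0")
    case True
    then have "d = - a" by (simp add: eq_neg_iff_add_eq_0 add.commute)
    with eq show ?thesis by (simp add: A trace_mat2_def det_mat2_def algebra_simps)
  next
    case False
    with eq have bc: "b = 0" "c = 0" by auto
    with eq have "a * a = 1" "d * d = 1" by auto
    then have "a = 1 \<or> a = - 1" "d = 1 \<or> d = - 1" by (simp_all add: square_eq_1_iff)
    with False bc show ?thesis by (auto simp: A mat2_defs)
  qed
qed

text \<open>If \<open>B\<close> is neither 1 nor -1, then \<open>A * B\<close> is an involution of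
  determinant 1, hence itself 1 or -1.\<close>

lemma commuting_involutions_mat2:
  assumes "A * A = 1" "B * B = 1" "A * B = B * A" "det_mat2 A = - 1"
  shows "B \<in> {1, - 1, A, - A}"
proof (cases "B \<in> {1, - 1}")
  case False
  then have "det_mat2 (A * B) = 1"
    using involution_mat2_cases[OF assms(2)] assms(4) by (simp add: det_mat2_mult)
  moreover have "(A * B) * (A * B) = A * A * (B * B)"
    using assms(3) by (metis mult.assoc)
  then have "(A * B) * (A * B) = 1" using assms(1,2) by simp
  ultimately have "A * B = 1 \<or> A * B = - 1"
    using involution_mat2_cases[of "A * B"] by auto
  moreover have "B = A * (A * B)" using assms(1) by (simp add: mult.assoc[symmetric])
  ultimately have "B = A \<or> B = - A" by auto
  then show ?thesis by auto
qed auto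

text \<open>With trace s, Cayley-Hamilton turns the cube into (s^2 - 1) A - s. As \<open>A\<close>
  is not scalar, s^2 = 1, and s = 1 would give 0 = 2.\<close>

lemma order_three_mat2:
  assumes "A * A * A = 1" "det_mat2 A = 1" "\<And>c. A \<noteq> scalar_mat2 c"
  shows "trace_mat2 A = - 1"
proof (rule ccontr)
  assume "trace_mat2 A \<noteq> - 1"
  define s where "s = trace_mat2 A"
  have sq: "A * A = scalar_mat2 s * A - 1"
    using cayley_hamilton_mat2[of A] assms(2) by (simp add: s_def scalar_mat2_simps)
  have "A * A * A = scalar_mat2 s * (A * A) - A"
    by (subst sq) (simp add: algebra_simps)
  also have "\<dots> = scalar_mat2 (s * s - 1) * A - scalar_mat2 s"
    by (subst sq) (simp add: scalar_mat2_def mat2_defs algebra_simps)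
  finally have *: "scalar_mat2 (s * s - 1) * A = scalar_mat2 (s + 1)"
    using assms(1) by (simp add: scalar_mat2_simps algebra_simps)
  show False
  proof (cases "s * s - 1 = 0")
    case True
    then have "s = 1" using \<open>trace_mat2 A \<noteq> - 1\<close> by (auto simp: s_def square_eq_1_iff)
    with * show False by (simp add: scalar_mat2_def mat2_defs)
  next
    case False
    then have "A = scalar_mat2 (1 / (s * s - 1)) * (scalar_mat2 (s * s - 1) * A)"
      by (cases A) (simp add: scalar_mat2_def mat2_defs)
    then show False
      using * assms(3) by (metis scalar_mat2_simps(4))
  qed
qed

section \<open>Images of the generators in a noncommutative representation\<close>

locale char2_rep = char2_truncated +
  fixes \<rho> :: "'a \<times> 'a \<times> 'a \<times> 'a \<Rightarrow> mat2"
  assumes rep: "noncommutative_rep (SL2 R) \<rho>"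
begin

definition U :: "'a \<Rightarrow> mat2" where "U x = \<rho> (upper x)"
definition W :: mat2 where "W = \<rho> weyl"
definition S :: mat2 where "S = U \<one>"

lemma rho_one: "\<rho> \<one>\<^bsub>SL2 R\<^esub> = 1"
  and rho_mult: "x \<in> carrier (SL2 R) \<Longrightarrow> y \<in> carrier (SL2 R) \<Longrightarrow> \<rho> (x \<otimes>\<^bsub>SL2 R\<^esub> y) = \<rho> x * \<rho> y"
  using rep by (auto simp: noncommutative_rep_def)

lemma U_add: "x \<in> carrier R \<Longrightarrow> y \<in> carrier R \<Longrightarrow> U (x \<oplus> y) = U x * U y"
  by (simp add: U_def upper_mult[symmetric] rho_mult)

lemma U_zero: "U \<zero> = 1"
  by (simp add: U_def upper_zero rho_one)

lemma U_square: "x \<in> carrier R \<Longrightarrow> U x * U x = 1"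
  by (simp add: U_add[symmetric] U_zero)

lemma U_commute: "x \<in> carrier R \<Longrightarrow> y \<in> carrier R \<Longrightarrow> U x * U y = U y * U x"
  by (metis U_add a_comm)

lemma W_square: "W * W = 1"
  by (simp add: W_def rho_mult[symmetric] weyl_weyl rho_one)

lemma S_square: "S * S = 1"
  by (simp add: S_def U_square)

lemma S_W_cube: "S * (W * (S * (W * (S * W)))) = 1"
  using upper_weyl_cube rho_one by (simp add: S_def U_def W_def rho_mult[symmetric])

lemma W_S_W: "W * S * W = S * W * S"
proof -
  have "S * W * S * (S * (W * (S * (W * (S * W))))) = W * S * W"
    by (simp add: mult.assoc) (simp add: mult.assoc[symmetric] S_square W_square)
  then show ?thesis by (simp add: S_W_cube)
qed

lemma commute_all:
  assumes "\<And>x. x \<in> carrier R \<Longrightarrow> A * U x = U x * A" "A * W = W * A" "g \<in> carrier (SL2 R)"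
  shows "A * \<rho> g = \<rho> g * A"
  using assms(3)
proof (induction g rule: SL2_induct)
  case one
  then show ?case by (simp add: rho_one)
next
  case (upper x g)
  then show ?case using assms(1)[of x] by (simp add: rho_mult U_def) (metis mult.assoc)
next
  case (weyl g)
  then show ?case using assms(2) by (simp add: rho_mult W_def) (metis mult.assoc)
qed

text \<open>If they commuted, the cube relation would give \<open>S * W = 1\<close>, hence
  \<open>W = S\<close>, which commutes with every \<open>U x\<close>.\<close>

lemma S_W_not_commute: "S * W \<noteq> W * S"
proof
  assume comm: "S * W = W * S"
  have "S * (W * (S * (W * (S * W)))) = S * W"
    by (metis comm S_square W_square mult.assoc mult_1_left)
  then have "S * W = 1" by (simp add: S_W_cube)
  then have "W = S" by (metis S_square mult.assoc mult_1_left mult_1_right)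
  then have UW: "U x * W = W * U x" if "x \<in> carrier R" for x
    using that by (simp add: S_def U_commute)
  \<comment> \<open>\<open>commute_all\<close> is used three times: for each \<open>U x\<close>,
    then for \<open>W\<close>, and finally for an arbitrary image, contradicting
    noncommutativity.\<close>
  have "U x * \<rho> g = \<rho> g * U x" if "x \<in> carrier R" "g \<in> carrier (SL2 R)" for x g
    using that by (intro commute_all) (auto intro: U_commute UW)
  moreover have "W * \<rho> g = \<rho> g * W" if "g \<in> carrier (SL2 R)" for g
    using that by (intro commute_all) (auto simp: UW)
  ultimately have "\<rho> h * \<rho> g = \<rho> g * \<rho> h" if "g \<in> carrier (SL2 R)" "h \<in> carrier (SL2 R)" for g h
    using that by (intro commute_all) auto
  then show False using rep by (auto simp: noncommutative_rep_def)
qed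

lemma S_trace_det: "trace_mat2 S = 0" "det_mat2 S = - 1"
  and W_trace_det: "trace_mat2 W = 0" "det_mat2 W = - 1"
  using involution_mat2_cases[OF S_square] involution_mat2_cases[OF W_square] S_W_not_commute
  by auto

lemma trace_S_W: "trace_mat2 (S * W) = - 1"
proof (rule order_three_mat2)
  show "S * W * (S * W) * (S * W) = 1" using S_W_cube by (simp add: mult.assoc)
  show "det_mat2 (S * W) = 1" by (simp add: det_mat2_mult S_trace_det W_trace_det)
  show "S * W \<noteq> scalar_mat2 c" for c
  proof
    assume "S * W = scalar_mat2 c"
    then have "S * (S * W) = S * W * S" by (simp add: scalar_mat2_simps)
    then show False using S_W_not_commute
      by (metis S_square mult.assoc mult_1_left)
  qed
qed

text \<open>By Cayley-Hamilton the square of \<open>S * W\<close> is \<open>- (S * W) - 1\<close>,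
  and the braid relation \<open>W_S_W\<close> identifies this square with
  \<open>W * S\<close>.\<close>

lemma W_S: "W * S = - 1 - S * W"
proof -
  have "S * W * (S * W) = - (S * W) - 1"
    using cayley_hamilton_mat2[of "S * W"]
    by (simp add: trace_S_W det_mat2_mult S_trace_det W_trace_det scalar_mat2_simps scalar_mat2_uminus)
  moreover have "S * W * (S * W) = W * S"
    using W_S_W by (metis S_square W_square mult.assoc mult_1_left mult_1_right)
  ultimately show ?thesis by simp
qed

lemma U_cases: "x \<in> carrier R \<Longrightarrow> U x \<in> {1, - 1, S, - S}"
  by (intro commuting_involutions_mat2 S_square U_square S_trace_det) (simp_all add: S_def U_commute)

lemma U_det_nonzero: "x \<in> carrier R \<Longrightarrow> det_mat2 (U x) \<noteq> 0"
  using U_cases[of x] by (auto simp: S_trace_det)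

lemma U_t_square_and_t:
  shows "y \<in> carrier R \<Longrightarrow> U (t \<otimes> (t \<otimes> y)) = 1" and "U t \<in> {1, - 1}"
proof -
  obtain b where b: "b \<in> carrier R" "(\<one> \<oplus> t) \<otimes> b = \<one>" "b \<otimes> (\<one> \<oplus> t) = \<one>"
    using one_add_t_unit[of \<one>] by (auto simp: Units_def)
  define D where "D = \<rho> (diag (\<one> \<oplus> t) b)"
  have "\<rho> (diag b (\<one> \<oplus> t)) * D = \<rho> (diag b (\<one> \<oplus> t) \<otimes>\<^bsub>SL2 R\<^esub> diag (\<one> \<oplus> t) b)"
    using b by (simp add: D_def rho_mult diag_closed)
  also have "diag b (\<one> \<oplus> t) \<otimes>\<^bsub>SL2 R\<^esub> diag (\<one> \<oplus> t) b = \<one>\<^bsub>SL2 R\<^esub>"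
    using b by (simp add: diag_def SL2_mult SL2_one)
  finally have "det_mat2 (\<rho> (diag b (\<one> \<oplus> t))) * det_mat2 D = 1"
    by (simp add: rho_one det_mat2_mult[symmetric])
  then have det_D: "det_mat2 D \<noteq> 0" by auto
  have conj: "D * U y = U y * U (t \<otimes> (t \<otimes> y)) * D" if y: "y \<in> carrier R" for y
  proof -
    have "(\<one> \<oplus> t) \<otimes> (\<one> \<oplus> t) \<otimes> y = y \<oplus> t \<otimes> (t \<otimes> y)"
      using y by (simp add: l_distr r_distr m_assoc a_assoc)
    with diag_upper[of "\<one> \<oplus> t" b y] b y show ?thesis
      by (simp add: D_def U_def rho_mult[symmetric] diag_closed upper_mult del: l_distr)
  qed
  \<comment> \<open>Taking determinants in \<open>conj\<close> gives determinant 1, which excludes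
    \<open>S\<close> and \<open>- S\<close>.\<close>
  have sign: "U (t \<otimes> (t \<otimes> y)) \<in> {1, - 1}" if y: "y \<in> carrier R" for y
  proof -
    have "det_mat2 (U (t \<otimes> (t \<otimes> y))) = 1"
      using arg_cong[OF conj[OF y], of det_mat2] det_D U_det_nonzero[OF y]
      by (simp add: det_mat2_mult)
    then show ?thesis using U_cases[of "t \<otimes> (t \<otimes> y)"] y by (auto simp: S_trace_det)
  qed
  \<comment> \<open>From b = 1 + tb and tb = t + t^2 b, both \<open>U b\<close> and
    \<open>U (t \<otimes> b)\<close> are expressed by \<open>S\<close>, \<open>U t\<close> and a
    sign.\<close>
  have tb: "t \<otimes> b = \<one> \<oplus> b"
    using b eq_add_swap[of b "t \<otimes> b" \<one>] by (auto simp: l_distr a_comm)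
  then have "b = \<one> \<oplus> t \<otimes> b" using b by simp
  then have U_b: "U b = S * U (t \<otimes> b)" using b by (metis S_def U_add m_closed one_closed t_closed)
  have "t \<otimes> b = t \<oplus> t \<otimes> (t \<otimes> b)" using b by (simp add: tb r_distr)
  then have U_tb: "U (t \<otimes> b) = U t * U (t \<otimes> (t \<otimes> b))"
    using b by (metis U_add m_closed t_closed)
  have D: "D = W * (U b * (W * (U t * (W * (S * (W * U (t \<otimes> b)))))))"
    using b by (simp add: D_def diag_factorization U_def W_def S_def rho_mult)
  have canc: "S * (S * A) = A" "W * (W * A) = A" for A
    by (simp_all add: mult.assoc[symmetric] S_square W_square)
  show t: "U t \<in> {1, - 1}"
  proof (rule ccontr)
    \<comment> \<open>Then \<open>U b\<close> is a sign and the factorization collapses to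
      \<open>W\<close> or \<open>- W\<close>. Now \<open>conj\<close> at y = 1 makes
      \<open>W * S\<close> equal to \<open>S * W\<close>, excluded by noncommutativity, or to its
      negative, excluded by \<open>W_S\<close>.\<close>
    assume "\<not> ?thesis"
    then have t: "U t \<in> {S, - S}" using U_cases[of t] by auto
    then have "U (t \<otimes> b) \<in> {S, - S}" using sign[OF b(1)] by (auto simp: U_tb)
    then have "D \<in> {W * (W * (S * (W * (S * (W * S))))), - (W * (W * (S * (W * (S * (W * S))))))}"
      using t by (auto simp: D U_b canc S_square)
    moreover have "S * (W * (S * (W * S))) = W"
      using W_S_W by (metis canc mult.assoc)
    ultimately have "D \<in> {W, - W}" by (simp add: canc)
    moreover have "D * S = S * U (t \<otimes> (t \<otimes> \<one>)) * D"
      unfolding S_def by (rule conj) simp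
    ultimately have "W * S = S * W \<or> W * S = - (S * W)"
      using sign[of \<one>] by (auto simp: minus_equation_iff[of "W * S"])
    then show False using S_W_not_commute W_S by auto
  qed
  show "U (t \<otimes> (t \<otimes> y)) = 1" if y: "y \<in> carrier R"
  proof -
    \<comment> \<open>Here \<open>U b\<close> is \<open>S\<close> up to sign, so \<open>D\<close> is
      1 or -1 and cancels from \<open>conj\<close>.\<close>
    have "U (t \<otimes> b) \<in> {1, - 1}" using sign[OF b(1)] t by (auto simp: U_tb)
    then have "D \<in> {1, - 1}" using t by (auto simp: D U_b canc S_square W_square)
    then have "U y = U y * U (t \<otimes> (t \<otimes> y))" using conj[OF y] by auto
    then have "U y * U y = U y * (U y * U (t \<otimes> (t \<otimes> y)))" by simp
    then show ?thesis using U_square[OF y] by (simp add: mult.assoc[symmetric])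
  qed
qed

text \<open>Coordinates relative to 1, \<open>S\<close>, \<open>W\<close> and \<open>S * W\<close>.
  Left multiplication by \<open>S\<close> and \<open>W\<close> changes them by formulas common to
  all representations, so different representations can be compared.\<close>

definition comb :: "complex \<Rightarrow> complex \<Rightarrow> complex \<Rightarrow> complex \<Rightarrow> mat2" where
  "comb \<alpha> \<beta> \<gamma> \<delta> = scalar_mat2 \<alpha> + scalar_mat2 \<beta> * S + scalar_mat2 \<gamma> * W + scalar_mat2 \<delta> * (S * W)"

lemma comb_one: "comb 1 0 0 0 = 1"
  by (simp add: comb_def scalar_mat2_simps)

lemma S_comb: "S * comb \<alpha> \<beta> \<gamma> \<delta> = comb \<beta> \<alpha> \<delta> \<gamma>"
proof -
  have *: "S * (scalar_mat2 c * A) = scalar_mat2 c * (S * A)" for c A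
    by (metis mult.assoc scalar_mat2_simps(5))
  have "S * (S * W) = W" by (simp add: mult.assoc[symmetric] S_square)
  then show ?thesis
    by (simp add: comb_def distrib_left * S_square scalar_mat2_simps(5) add_ac)
qed

lemma W_comb: "W * comb \<alpha> \<beta> \<gamma> \<delta> = comb (\<gamma> - \<beta>) (- \<delta>) (\<alpha> - \<delta>) (- \<beta>)"
proof -
  have *: "W * (scalar_mat2 c * A) = scalar_mat2 c * (W * A)" for c A
    by (metis mult.assoc scalar_mat2_simps(5))
  have "W * (S * W) = W * S * W" by (simp only: mult.assoc)
  also have "\<dots> = - W - S" by (simp add: W_S left_diff_distrib mult.assoc W_square)
  finally have WSW: "W * (S * W) = - W - S" .
  show ?thesis
    unfolding comb_def distrib_left * W_square W_S WSW scalar_mat2_simps(5)[of W]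
    by (simp add: scalar_mat2_uminus scalar_mat2_diff algebra_simps)
qed

lemma uminus_comb: "- comb \<alpha> \<beta> \<gamma> \<delta> = comb (- \<alpha>) (- \<beta>) (- \<gamma>) (- \<delta>)"
  by (simp add: comb_def scalar_mat2_uminus)

lemma trace_comb: "trace_mat2 (comb \<alpha> \<beta> \<gamma> \<delta>) = 2 * \<alpha> - \<delta>"
  by (simp add: comb_def S_trace_det W_trace_det trace_S_W)
     (simp add: trace_mat2_def scalar_mat2_def)

end

section \<open>The character is determined by the image of u(t)\<close>

context char2_truncated
begin

text \<open>Two applications of \<open>decomposition\<close> leave four residues modulo t^2, on
  which \<open>U\<close> is expressed by \<open>S\<close> and \<open>U t\<close>.\<close>

lemma decomposition_square:
  assumes "x \<in> carrier R"
  obtains z e where "z \<in> carrier R" "e \<in> {\<zero>, t, \<one>, \<one> \<oplus> t}" "x = e \<oplus> t \<otimes> (t \<otimes> z)"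
proof -
  obtain y where y: "y \<in> carrier R" "x = t \<otimes> y \<or> x = \<one> \<oplus> t \<otimes> y"
    using decomposition[OF assms] by blast
  moreover obtain z where z: "z \<in> carrier R" "y = t \<otimes> z \<or> y = \<one> \<oplus> t \<otimes> z"
    using decomposition[OF y(1)] by blast
  ultimately show thesis
    using that[of z \<zero>] that[of z t] that[of z \<one>] that[of z "\<one> \<oplus> t"]
    by (auto simp: r_distr a_assoc)
qed

text \<open>Along words in the generators both images keep equal coordinates, because u(t) acts by
  the same sign in both and u(t^2 z) acts trivially.\<close>

lemma trace_eqI:
  assumes "char2_rep R t n \<rho>" "char2_rep R t n \<rho>'" "\<rho> (upper t) = \<rho>' (upper t)"
    "g \<in> carrier (SL2 R)"
  shows "trace_mat2 (\<rho> g) = trace_mat2 (\<rho>' g)"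
proof -
  interpret r: char2_rep R t n \<rho> by fact
  interpret r': char2_rep R t n \<rho>' by fact
  have "\<exists>\<alpha> \<beta> \<gamma> \<delta>. \<rho> g = r.comb \<alpha> \<beta> \<gamma> \<delta> \<and> \<rho>' g = r'.comb \<alpha> \<beta> \<gamma> \<delta>"
    using assms(4)
  proof (induction g rule: SL2_induct)
    case one
    then show ?case by (metis r.comb_one r'.comb_one r.rho_one r'.rho_one)
  next
    case (upper x g)
    then obtain \<alpha> \<beta> \<gamma> \<delta> where IH: "\<rho> g = r.comb \<alpha> \<beta> \<gamma> \<delta>" "\<rho>' g = r'.comb \<alpha> \<beta> \<gamma> \<delta>" by blast
    obtain z e where z: "z \<in> carrier R" "e \<in> {\<zero>, t, \<one>, \<one> \<oplus> t}" "x = e \<oplus> t \<otimes> (t \<otimes> z)"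
      using decomposition_square[OF upper(1)] by blast
    then have "e \<in> carrier R" by auto
    then have x: "r.U x = r.U e" "r'.U x = r'.U e"
      using z by (simp_all add: r.U_add r'.U_add r.U_t_square_and_t r'.U_t_square_and_t)
    have t: "r.U t = 1 \<and> r'.U t = 1 \<or> r.U t = - 1 \<and> r'.U t = - 1"
      using r.U_t_square_and_t(2) assms(3) by (auto simp: r.U_def r'.U_def)
    have "(r.U x, r'.U x) \<in> {(1, 1), (- 1, - 1), (r.S, r'.S), (- r.S, - r'.S)}"
      using z(2) t unfolding x
      by (auto simp: r.U_zero r'.U_zero r.U_add r'.U_add r.S_def r'.S_def)
    then have "\<exists>\<alpha>' \<beta>' \<gamma>' \<delta>'. r.U x * r.comb \<alpha> \<beta> \<gamma> \<delta> = r.comb \<alpha>' \<beta>' \<gamma>' \<delta>' \<and>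
        r'.U x * r'.comb \<alpha> \<beta> \<gamma> \<delta> = r'.comb \<alpha>' \<beta>' \<gamma>' \<delta>'"
      by (auto simp: r.S_comb r'.S_comb r.uminus_comb r'.uminus_comb) blast+
    then show ?case
      using upper IH by (simp add: r.rho_mult r'.rho_mult r.U_def r'.U_def)
  next
    case (weyl g)
    then obtain \<alpha> \<beta> \<gamma> \<delta> where IH: "\<rho> g = r.comb \<alpha> \<beta> \<gamma> \<delta>" "\<rho>' g = r'.comb \<alpha> \<beta> \<gamma> \<delta>" by blast
    then have "\<rho> (weyl \<otimes>\<^bsub>SL2 R\<^esub> g) = r.W * r.comb \<alpha> \<beta> \<gamma> \<delta>"
      "\<rho>' (weyl \<otimes>\<^bsub>SL2 R\<^esub> g) = r'.W * r'.comb \<alpha> \<beta> \<gamma> \<delta>"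
      using weyl by (simp_all add: r.rho_mult r'.rho_mult r.W_def r'.W_def)
    then show ?case by (metis r.W_comb r'.W_comb)
  qed
  then show ?thesis by (auto simp: r.trace_comb r'.trace_comb)
qed

end

section \<open>Transfer of representations along isomorphisms of group algebras\<close>

definition algebra_rep :: "(complex, 'a) module \<Rightarrow> ('a \<Rightarrow> mat2) \<Rightarrow> bool" where
  "algebra_rep A \<phi> \<longleftrightarrow> \<phi> \<one>\<^bsub>A\<^esub> = 1 \<and>
    (\<forall>x\<in>carrier A. \<forall>y\<in>carrier A. \<phi> (x \<oplus>\<^bsub>A\<^esub> y) = \<phi> x + \<phi> y \<and> \<phi> (x \<otimes>\<^bsub>A\<^esub> y) = \<phi> x * \<phi> y) \<and>
    (\<forall>c. \<forall>x\<in>carrier A. \<phi> (c \<odot>\<^bsub>A\<^esub> x) = scalar_mat2 c * \<phi> x)"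

lemma algebra_repD:
  assumes "algebra_rep A \<phi>"
  shows "\<phi> \<one>\<^bsub>A\<^esub> = 1"
    and "x \<in> carrier A \<Longrightarrow> y \<in> carrier A \<Longrightarrow> \<phi> (x \<oplus>\<^bsub>A\<^esub> y) = \<phi> x + \<phi> y"
    and "x \<in> carrier A \<Longrightarrow> y \<in> carrier A \<Longrightarrow> \<phi> (x \<otimes>\<^bsub>A\<^esub> y) = \<phi> x * \<phi> y"
    and "x \<in> carrier A \<Longrightarrow> \<phi> (c \<odot>\<^bsub>A\<^esub> x) = scalar_mat2 c * \<phi> x"
  using assms by (simp_all add: algebra_rep_def)

lemma algebra_rep_inverse:
  assumes "ring A" "ring B" "h \<in> ring_iso A B"
    and "\<And>c x. x \<in> carrier A \<Longrightarrow> h (c \<odot>\<^bsub>A\<^esub> x) = c \<odot>\<^bsub>B\<^esub> h x"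
    and smult: "\<And>c x. x \<in> carrier A \<Longrightarrow> c \<odot>\<^bsub>A\<^esub> x \<in> carrier A"
    and "algebra_rep A \<phi>"
  shows "algebra_rep B (\<phi> \<circ> inv_into (carrier A) h)"
proof -
  interpret A: ring A by fact
  define k where "k = inv_into (carrier A) h"
  have bij: "bij_betw h (carrier A) (carrier B)" and hom: "h \<in> ring_hom A B"
    using assms(3) by (auto simp: ring_iso_def)
  have k: "k (h x) = x" if "x \<in> carrier A" for x
    using bij that by (simp add: k_def bij_betw_inv_into_left)
  have surj: "\<exists>x\<in>carrier A. y = h x" if "y \<in> carrier B" for y
    using bij that by (auto simp: bij_betw_def)
  show ?thesis
    unfolding algebra_rep_def o_def k_def[symmetric]
  proof (intro conjI ballI allI)
    show "\<phi> (k \<one>\<^bsub>B\<^esub>) = 1"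
      using k[of "\<one>\<^bsub>A\<^esub>"] ring_hom_one[OF hom] algebra_repD(1)[OF assms(6)] by simp
  next
    fix x y assume "x \<in> carrier B" "y \<in> carrier B"
    then obtain x' y' where xy: "x' \<in> carrier A" "y' \<in> carrier A" "x = h x'" "y = h y'"
      using surj by metis
    show "\<phi> (k (x \<oplus>\<^bsub>B\<^esub> y)) = \<phi> (k x) + \<phi> (k y)"
      using xy ring_hom_add[OF hom, of x' y', symmetric] algebra_repD(2)[OF assms(6)] by (simp add: k)
    show "\<phi> (k (x \<otimes>\<^bsub>B\<^esub> y)) = \<phi> (k x) * \<phi> (k y)"
      using xy ring_hom_mult[OF hom, of x' y', symmetric] algebra_repD(3)[OF assms(6)] by (simp add: k)
  next
    fix c x assume "x \<in> carrier B"
    then obtain x' where x: "x' \<in> carrier A" "x = h x'" using surj by metis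
    show "\<phi> (k (c \<odot>\<^bsub>B\<^esub> x)) = scalar_mat2 c * \<phi> (k x)"
      using x assms(4)[OF x(1), of c, symmetric] algebra_repD(4)[OF assms(6)] by (simp add: k smult)
  qed
qed

section \<open>Linear extension and restriction to group elements\<close>

definition delta :: "'g \<Rightarrow> 'g \<Rightarrow> complex" where
  "delta g = (\<lambda>x. if x = g then 1 else 0)"

text \<open>Formed entry by entry, so that only sums of complex numbers occur.\<close>

definition linear_extension :: "('g \<Rightarrow> mat2) \<Rightarrow> ('g \<Rightarrow> complex) \<Rightarrow> mat2" where
  "linear_extension \<rho> f = (let s = (\<lambda>p. \<Sum>x | f x \<noteq> 0. f x * p (\<rho> x)) in Mat2 (s m11) (s m12) (s m21) (s m22))"

lemma linear_extension_superset:
  assumes "finite B" "{x. f x \<noteq> 0} \<subseteq> B"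
  shows "linear_extension \<rho> f = Mat2 (\<Sum>x\<in>B. f x * m11 (\<rho> x)) (\<Sum>x\<in>B. f x * m12 (\<rho> x))
    (\<Sum>x\<in>B. f x * m21 (\<rho> x)) (\<Sum>x\<in>B. f x * m22 (\<rho> x))"
proof -
  have "(\<Sum>x | f x \<noteq> 0. f x * p x) = (\<Sum>x\<in>B. f x * p x)" for p
    using assms by (intro sum.mono_neutral_left) auto
  then show ?thesis by (simp add: linear_extension_def)
qed

lemma linear_extension_delta: "linear_extension \<rho> (delta g) = \<rho> g"
proof -
  have "(\<Sum>x\<in>{g}. delta g x * p x) = p g" for p :: "'a \<Rightarrow> complex"
    by (simp add: delta_def)
  then show ?thesis
    by (subst linear_extension_superset[of "{g}"]) (auto simp: delta_def)
qed

context monoid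
begin

lemma complex_group_algebra_carrier:
  "f \<in> carrier (complex_group_algebra G) \<longleftrightarrow> {x. f x \<noteq> 0} \<subseteq> carrier G \<and> finite {x. f x \<noteq> 0}"
  by (simp add: complex_group_algebra_def)

lemma delta_closed: "g \<in> carrier G \<Longrightarrow> delta g \<in> carrier (complex_group_algebra G)"
  by (auto simp: complex_group_algebra_carrier delta_def)

lemma delta_mult: "delta g \<otimes>\<^bsub>complex_group_algebra G\<^esub> delta h = delta (g \<otimes> h)"
  by (rule ext, subst complex_group_algebra_mult[of "{g}" "{h}"]) (auto simp: delta_def)

lemma delta_one: "delta \<one> = \<one>\<^bsub>complex_group_algebra G\<^esub>"
  by (simp add: complex_group_algebra_def delta_def)

lemma smult_closed:
  "f \<in> carrier (complex_group_algebra G) \<Longrightarrow> c \<odot>\<^bsub>complex_group_algebra G\<^esub> f \<in> carrier (complex_group_algebra G)"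
  using module.smult_closed[OF module_complex_group_algebra] by (simp add: ring_of_type_algebra_def)

text \<open>The zero element is written as a multiple of the unit because \<open>algebra_rep\<close>
  evaluates that form directly.\<close>

lemma complex_group_algebra_induct [consumes 1, case_names zero add]:
  assumes f: "f \<in> carrier (complex_group_algebra G)"
    and zero: "P (0 \<odot>\<^bsub>complex_group_algebra G\<^esub> \<one>\<^bsub>complex_group_algebra G\<^esub>)"
    and add: "\<And>c g f. g \<in> carrier G \<Longrightarrow> f \<in> carrier (complex_group_algebra G) \<Longrightarrow> P f \<Longrightarrow>
      P (c \<odot>\<^bsub>complex_group_algebra G\<^esub> delta g \<oplus>\<^bsub>complex_group_algebra G\<^esub> f)"
  shows "P f"
proof -
  have "finite {x. f x \<noteq> 0}" using f by (simp add: complex_group_algebra_carrier)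
  moreover have "P f" if "finite F" "F = {x. f x \<noteq> 0}" "F \<subseteq> carrier G" for F f
    using that
  proof (induction F arbitrary: f rule: finite_induct)
    case empty
    then have "f = (\<lambda>x. 0)" by auto
    then show ?case using zero by (simp add: complex_group_algebra_def)
  next
    case (insert g F)
    define f' where "f' = f(g := 0)"
    have supp: "F = {x. f' x \<noteq> 0}" using insert by (auto simp: f'_def)
    have F: "F \<subseteq> carrier G" using insert.prems by blast
    have "P f'" by (rule insert.IH[OF supp F])
    moreover have "f' \<in> carrier (complex_group_algebra G)"
      using insert.hyps(1) F unfolding complex_group_algebra_carrier supp by blast
    moreover have "f = f g \<odot>\<^bsub>complex_group_algebra G\<^esub> delta g \<oplus>\<^bsub>complex_group_algebra G\<^esub> f'"
      by (auto simp: complex_group_algebra_def delta_def f'_def)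
    ultimately show ?case using add insert.prems by (metis insert_subset)
  qed
  ultimately show ?thesis using f by (auto simp: complex_group_algebra_carrier)
qed

lemma algebra_rep_linear_extension:
  assumes "noncommutative_rep G \<rho>"
  shows "algebra_rep (complex_group_algebra G) (linear_extension \<rho>)"
  unfolding algebra_rep_def
proof (intro conjI ballI allI)
  let ?A = "complex_group_algebra G"
  interpret A: ring ?A by (rule ring_complex_group_algebra)
  show "linear_extension \<rho> \<one>\<^bsub>?A\<^esub> = 1"
    using assms by (simp add: delta_one[symmetric] linear_extension_delta noncommutative_rep_def)
  fix f assume f: "f \<in> carrier ?A"
  show "linear_extension \<rho> (c \<odot>\<^bsub>?A\<^esub> f) = scalar_mat2 c * linear_extension \<rho> f" for c
    using f by (subst (1 2) linear_extension_superset[of "{x. f x \<noteq> 0}"])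
      (auto simp: complex_group_algebra_def scalar_mat2_def times_mat2_def sum_distrib_left mult_ac)
  fix g assume g: "g \<in> carrier ?A"
  \<comment> \<open>Common finite sets containing the supports of \<open>f\<close>, \<open>g\<close>
    and of their product, so that all sums have fixed ranges.\<close>
  define B C where "B = {x. f x \<noteq> 0} \<union> {x. g x \<noteq> 0}" and "C = (\<lambda>(y, z). y \<otimes> z) ` (B \<times> B)"
  have fin: "finite B" "finite C" and B: "B \<subseteq> carrier G"
    using f g by (auto simp: B_def C_def complex_group_algebra_carrier)
  have supp: "{x. f x \<noteq> 0} \<subseteq> B" "{x. g x \<noteq> 0} \<subseteq> B" by (auto simp: B_def)
  note ext = linear_extension_superset[OF fin(1) supp(1)] linear_extension_superset[OF fin(1) supp(2)]
  show "linear_extension \<rho> (f \<oplus>\<^bsub>?A\<^esub> g) = linear_extension \<rho> f + linear_extension \<rho> g"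
    unfolding ext
    by (subst linear_extension_superset[OF fin(1)])
      (auto simp: B_def complex_group_algebra_def plus_mat2_def sum.distrib distrib_right)
  have "{x. (f \<otimes>\<^bsub>?A\<^esub> g) x \<noteq> 0} \<subseteq> C"
  proof
    fix x assume "x \<in> {x. (f \<otimes>\<^bsub>?A\<^esub> g) x \<noteq> 0}"
    then obtain y z where "f y \<noteq> 0" "g z \<noteq> 0" "x = y \<otimes> z"
      by (auto elim: complex_group_algebra_mult_support)
    then show "x \<in> C" by (auto simp: C_def B_def)
  qed
  note ext_mult = linear_extension_superset[OF fin(2) this]
  have mult_sum: "(\<Sum>x\<in>C. (f \<otimes>\<^bsub>?A\<^esub> g) x * p x) = (\<Sum>y\<in>B. \<Sum>z\<in>B. f y * g z * p (y \<otimes> z))" for p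
    using fin supp by (intro complex_group_algebra_mult_sum) (auto simp: C_def)
  have \<rho>: "\<rho> (y \<otimes> z) = \<rho> y * \<rho> z" if "y \<in> B" "z \<in> B" for y z
    using assms that B by (auto simp: noncommutative_rep_def)
  show "linear_extension \<rho> (f \<otimes>\<^bsub>?A\<^esub> g) = linear_extension \<rho> f * linear_extension \<rho> g"
    unfolding ext ext_mult mult_sum
    by (simp add: times_mat2_def sum_product sum.distrib[symmetric] \<rho> algebra_simps cong: sum.cong)
qed

lemma noncommutative_rep_delta:
  assumes rep: "algebra_rep (complex_group_algebra G) \<phi>"
    and "x \<in> carrier (complex_group_algebra G)" "y \<in> carrier (complex_group_algebra G)"
      "\<phi> x * \<phi> y \<noteq> \<phi> y * \<phi> x"
  shows "noncommutative_rep G (\<lambda>g. \<phi> (delta g))"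
proof -
  let ?A = "complex_group_algebra G"
  interpret A: ring ?A by (rule ring_complex_group_algebra)
  note repD = algebra_repD[OF rep]
  have commute: "M * \<phi> f = \<phi> f * M"
    if "\<And>g. g \<in> carrier G \<Longrightarrow> M * \<phi> (delta g) = \<phi> (delta g) * M" "f \<in> carrier ?A" for M f
    using that(2)
  proof (induction rule: complex_group_algebra_induct)
    case zero
    then show ?case by (simp add: repD scalar_mat2_simps)
  next
    case (add c g f)
    have "M * (scalar_mat2 c * \<phi> (delta g)) = scalar_mat2 c * \<phi> (delta g) * M"
      using that(1)[OF add(1)] by (metis mult.assoc scalar_mat2_simps(5))
    then show ?case
      using add by (simp add: repD delta_closed smult_closed distrib_left distrib_right)
  qed
  \<comment> \<open>If all images of group elements commuted, applying \<open>commute\<close> once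
    in each argument would make the images of \<open>x\<close> and \<open>y\<close> commute.\<close>
  have "\<exists>g\<in>carrier G. \<exists>h\<in>carrier G. \<phi> (delta g) * \<phi> (delta h) \<noteq> \<phi> (delta h) * \<phi> (delta g)"
    using commute assms(2-4) by metis
  then show ?thesis
    by (simp add: noncommutative_rep_def delta_mult[symmetric] delta_one repD delta_closed)
qed

lemma trace_eq_of_delta:
  assumes "algebra_rep (complex_group_algebra G) \<phi>" "algebra_rep (complex_group_algebra G) \<psi>"
    and "\<And>g. g \<in> carrier G \<Longrightarrow> trace_mat2 (\<phi> (delta g)) = trace_mat2 (\<psi> (delta g))"
    and "f \<in> carrier (complex_group_algebra G)"
  shows "trace_mat2 (\<phi> f) = trace_mat2 (\<psi> f)"
proof -
  interpret A: ring "complex_group_algebra G" by (rule ring_complex_group_algebra)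
  note repD = algebra_repD[OF assms(1)] algebra_repD[OF assms(2)]
  show ?thesis using assms(4)
    by (induction rule: complex_group_algebra_induct)
      (simp_all add: repD delta_closed smult_closed assms(3))
qed

end

text \<open>\<open>F\<close> extends linearly, pulls back along the inverse isomorphism and
  restricts to \<open>H\<close>. Traces on \<open>H\<close> determine those on the whole algebra, in
  particular at the images of elements of \<open>G\<close>, so distinct characters stay
  distinct.\<close>

lemma transfer_noncommutative_reps:
  assumes iso: "complex_algebra_isomorphic (complex_group_algebra G) (complex_group_algebra H)"
    and G: "Group.monoid G" and H: "Group.monoid H"
  obtains F where "\<And>\<rho>. noncommutative_rep G \<rho> \<Longrightarrow> noncommutative_rep H (F \<rho>)"
    and "\<And>\<rho> \<rho>' g. noncommutative_rep G \<rho> \<Longrightarrow> noncommutative_rep G \<rho>' \<Longrightarrow>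
      (\<And>h. h \<in> carrier H \<Longrightarrow> trace_mat2 (F \<rho> h) = trace_mat2 (F \<rho>' h)) \<Longrightarrow>
      g \<in> carrier G \<Longrightarrow> trace_mat2 (\<rho> g) = trace_mat2 (\<rho>' g)"
proof -
  let ?A = "complex_group_algebra G" and ?B = "complex_group_algebra H"
  interpret G: Group.monoid G by fact
  interpret H: Group.monoid H by fact
  interpret A: ring ?A by (rule G.ring_complex_group_algebra)
  obtain h where h: "h \<in> ring_iso ?A ?B" "\<And>c x. x \<in> carrier ?A \<Longrightarrow> h (c \<odot>\<^bsub>?A\<^esub> x) = c \<odot>\<^bsub>?B\<^esub> h x"
    using iso by (auto simp: complex_algebra_isomorphic_def)
  define k where "k = inv_into (carrier ?A) h"
  have k: "h x \<in> carrier ?B" "k (h x) = x" if "x \<in> carrier ?A" for x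
    using h(1) that by (auto simp: k_def ring_iso_def bij_betw_def)
  define \<psi> where "\<psi> \<rho> = linear_extension \<rho> \<circ> k" for \<rho>
  have \<psi>: "algebra_rep ?B (\<psi> \<rho>)" if "noncommutative_rep G \<rho>" for \<rho>
    unfolding \<psi>_def k_def
    by (intro algebra_rep_inverse G.ring_complex_group_algebra H.ring_complex_group_algebra h
        G.smult_closed G.algebra_rep_linear_extension that)
  have \<psi>_h: "\<psi> \<rho> (h (delta g)) = \<rho> g" if "g \<in> carrier G" for \<rho> g
    using that by (simp add: \<psi>_def k G.delta_closed linear_extension_delta)
  show thesis
  proof (rule that[of "\<lambda>\<rho> g. \<psi> \<rho> (delta g)"])
    fix \<rho> assume rep: "noncommutative_rep G \<rho>"
    then obtain x y where "x \<in> carrier G" "y \<in> carrier G" "\<rho> x * \<rho> y \<noteq> \<rho> y * \<rho> x"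
      by (auto simp: noncommutative_rep_def)
    then show "noncommutative_rep H (\<lambda>g. \<psi> \<rho> (delta g))"
      using H.noncommutative_rep_delta[OF \<psi>[OF rep], of "h (delta x)" "h (delta y)"]
      by (simp add: \<psi>_h k G.delta_closed)
  next
    fix \<rho> \<rho>' g
    assume "noncommutative_rep G \<rho>" "noncommutative_rep G \<rho>'" "g \<in> carrier G"
      "\<And>h. h \<in> carrier H \<Longrightarrow> trace_mat2 (\<psi> \<rho> (delta h)) = trace_mat2 (\<psi> \<rho>' (delta h))"
    then show "trace_mat2 (\<rho> g) = trace_mat2 (\<rho>' g)"
      using H.trace_eq_of_delta[OF \<psi> \<psi>, of \<rho> \<rho>' "h (delta g)"]
      by (simp add: \<psi>_h k G.delta_closed)
  qed
qed

section \<open>The two families of groups\<close>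

lemma (in UP_cring) constant_term_decomposition:
  assumes p: "p \<in> carrier P"
  shows "\<exists>q\<in>carrier P. p = up_ring.monom P (up_ring.coeff P p 0) 0 \<oplus>\<^bsub>P\<^esub> up_ring.monom P \<one> 1 \<otimes>\<^bsub>P\<^esub> q"
proof
  define m where "m i = up_ring.monom P (up_ring.coeff P p i) i" for i
  \<comment> \<open>The coefficients are shifted down by one. The top summand vanishes; keeping it
    lets the sum match the expansion of \<open>p\<close> up to \<open>Suc (deg R p)\<close>.\<close>
  define q where "q = (\<Oplus>\<^bsub>P\<^esub> i \<in> {..deg R p}. up_ring.monom P (up_ring.coeff P p (Suc i)) i)"
  show q: "q \<in> carrier P" unfolding q_def using p by (intro P.finsum_closed) auto
  have "up_ring.monom P \<one> 1 \<otimes>\<^bsub>P\<^esub> q = (\<Oplus>\<^bsub>P\<^esub> i \<in> {..deg R p}. up_ring.monom P \<one> 1 \<otimes>\<^bsub>P\<^esub> up_ring.monom P (up_ring.coeff P p (Suc i)) i)"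
    unfolding q_def using p by (intro P.finsum_rdistr) auto
  also have "\<dots> = (\<Oplus>\<^bsub>P\<^esub> i \<in> {..deg R p}. m (Suc i))"
    using p by (intro P.finsum_cong') (auto simp: m_def monom_mult[symmetric] simp del: monom_mult)
  finally have "up_ring.monom P \<one> 1 \<otimes>\<^bsub>P\<^esub> q = \<dots>" .
  moreover have "p = (\<Oplus>\<^bsub>P\<^esub> i \<in> {..Suc (deg R p)}. m i)"
    unfolding m_def using p by (intro up_repr_le[symmetric]) auto
  moreover have "\<dots> = (\<Oplus>\<^bsub>P\<^esub> i \<in> {..deg R p}. m (Suc i)) \<oplus>\<^bsub>P\<^esub> m 0"
    using p by (intro P.finsum_Suc2) (auto simp: m_def)
  ultimately show "p = up_ring.monom P (up_ring.coeff P p 0) 0 \<oplus>\<^bsub>P\<^esub> up_ring.monom P \<one> 1 \<otimes>\<^bsub>P\<^esub> q"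
    using p q by (simp add: m_def P.a_comm)
qed

text \<open>The element t is the class of the monomial of degree one; the constant term of a
  representative is 0 or 1, which gives the decomposition.\<close>

lemma char2_truncated_poly_ring: "\<exists>t. char2_truncated (truncated_poly_ring (residue_ring 2) n) t n"
proof -
  interpret F: residues 2 "residue_ring 2" by unfold_locales auto
  interpret UP_cring "residue_ring 2" "UP (residue_ring 2)"
    by (simp add: UP_cring_def F.cring_axioms)
  let ?F = "residue_ring 2" and ?P = "UP (residue_ring 2)"
  define I where "I = PIdl\<^bsub>?P\<^esub> (up_ring.monom ?P \<one>\<^bsub>?F\<^esub> n)"
  define Q where "Q = truncated_poly_ring ?F n"
  have Q: "Q = ?P Quot I" by (simp add: Q_def truncated_poly_ring_def I_def)
  have X: "up_ring.monom ?P \<one>\<^bsub>?F\<^esub> k \<in> carrier ?P" for k by simp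
  interpret I: ideal I ?P unfolding I_def by (rule P.cgenideal_ideal[OF X])
  interpret Q: cring Q unfolding Q_def by (rule F.cring_truncated_poly_ring)
  define h where "h = (\<lambda>p. I +>\<^bsub>?P\<^esub> p)"
  interpret h: ring_hom_cring ?P Q h
    unfolding h_def Q by (intro I.rcos_ring_hom_cring P.cring_axioms)
  define t where "t = h (up_ring.monom ?P \<one>\<^bsub>?F\<^esub> 1)"
  have surj: "\<exists>p\<in>carrier ?P. x = h p" if "x \<in> carrier Q" for x
    using that by (auto simp: Q h_def FactRing_def A_RCOSETS_def')
  have "\<one>\<^bsub>?F\<^esub> \<oplus>\<^bsub>?F\<^esub> \<one>\<^bsub>?F\<^esub> = \<zero>\<^bsub>?F\<^esub>"
    by (simp add: F.res_add_eq F.res_one_eq F.res_zero_eq)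
  then have char2P: "\<one>\<^bsub>?P\<^esub> \<oplus>\<^bsub>?P\<^esub> \<one>\<^bsub>?P\<^esub> = \<zero>\<^bsub>?P\<^esub>"
    using monom_add[of "\<one>\<^bsub>?F\<^esub>" "\<one>\<^bsub>?F\<^esub>" 0] by (simp add: monom_one del: monom_add)
  have "char2_truncated Q t n"
  proof
    show "\<one>\<^bsub>Q\<^esub> \<oplus>\<^bsub>Q\<^esub> \<one>\<^bsub>Q\<^esub> = \<zero>\<^bsub>Q\<^esub>"
      using arg_cong[OF char2P, of h] by simp
    show "t \<in> carrier Q" by (simp add: t_def)
    have "t [^]\<^bsub>Q\<^esub> n = h (up_ring.monom ?P \<one>\<^bsub>?F\<^esub> 1 [^]\<^bsub>?P\<^esub> n)"
      by (simp add: t_def)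
    moreover have "up_ring.monom ?P \<one>\<^bsub>?F\<^esub> 1 [^]\<^bsub>?P\<^esub> n = up_ring.monom ?P \<one>\<^bsub>?F\<^esub> n"
      by (simp add: monom_pow)
    moreover have "up_ring.monom ?P \<one>\<^bsub>?F\<^esub> n \<in> I" unfolding I_def by (rule P.cgenideal_self[OF X])
    then have "h (up_ring.monom ?P \<one>\<^bsub>?F\<^esub> n) = \<zero>\<^bsub>Q\<^esub>"
      by (simp add: h_def Q FactRing_def I.a_rcos_const)
    ultimately show "t [^]\<^bsub>Q\<^esub> n = \<zero>\<^bsub>Q\<^esub>" by (simp only:)
  next
    fix x assume "x \<in> carrier Q"
    then obtain p where p: "p \<in> carrier ?P" "x = h p" using surj by blast
    obtain q where q: "q \<in> carrier ?P"
      "p = up_ring.monom ?P (up_ring.coeff ?P p 0) 0 \<oplus>\<^bsub>?P\<^esub> up_ring.monom ?P \<one>\<^bsub>?F\<^esub> 1 \<otimes>\<^bsub>?P\<^esub> q"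
      using constant_term_decomposition[OF p(1)] by blast
    have "up_ring.coeff ?P p 0 \<in> carrier ?F" using p by simp
    then have "up_ring.coeff ?P p 0 \<in> {\<zero>\<^bsub>?F\<^esub>, \<one>\<^bsub>?F\<^esub>}"
      by (auto simp: F.res_carrier_eq F.res_one_eq F.res_zero_eq)
    then have "p = up_ring.monom ?P \<one>\<^bsub>?F\<^esub> 1 \<otimes>\<^bsub>?P\<^esub> q \<or>
        p = \<one>\<^bsub>?P\<^esub> \<oplus>\<^bsub>?P\<^esub> up_ring.monom ?P \<one>\<^bsub>?F\<^esub> 1 \<otimes>\<^bsub>?P\<^esub> q"
      using q by auto
    then have "x = t \<otimes>\<^bsub>Q\<^esub> h q \<or> x = \<one>\<^bsub>Q\<^esub> \<oplus>\<^bsub>Q\<^esub> t \<otimes>\<^bsub>Q\<^esub> h q"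
      using q(1) unfolding p(2) t_def by auto
    then show "\<exists>y\<in>carrier Q. x = t \<otimes>\<^bsub>Q\<^esub> y \<or> x = \<one>\<^bsub>Q\<^esub> \<oplus>\<^bsub>Q\<^esub> t \<otimes>\<^bsub>Q\<^esub> y"
      using q(1) by blast
  qed
  then show ?thesis unfolding Q_def by blast
qed

text \<open>\<open>rho\<close> reads residues as integers and depends on them only modulo 8, so it
  respects multiplication modulo any multiple of 8.\<close>

lemma (in theta_rep) noncommutative_rep_rho:
  assumes m: "8 dvd m" "m > 1"
  shows "noncommutative_rep (SL2 (residue_ring m)) rho"
    and "(1, 1, 0, 1) \<in> carrier (SL2 (residue_ring m))"
    and "trace_mat2 (rho (1, 1, 0, 1)) = \<theta>"
proof -
  interpret R: residues m "residue_ring m" by unfold_locales (use m in auto)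
  let ?G = "SL2 (residue_ring m)"
  have minus: "x \<ominus>\<^bsub>residue_ring m\<^esub> y = (x - y) mod m" if "y \<in> carrier (residue_ring m)" for x y
    by (simp add: a_minus_def R.res_neg_eq R.res_add_eq mod_add_right_eq)
  have carrier: "(a, b, c, d) \<in> carrier ?G \<longleftrightarrow> a \<in> {0..<m} \<and> b \<in> {0..<m} \<and> c \<in> {0..<m} \<and>
      d \<in> {0..<m} \<and> [a * d - b * c = 1] (mod m)" for a b c d
    using m(2) by (auto simp: SL2_def minus R.res_carrier_eq R.res_mult_eq R.res_one_eq
        cong_def mod_diff_eq)
  have mult: "(a, b, c, d) \<otimes>\<^bsub>?G\<^esub> (a', b', c', d') =
      ((a * a' + b * c') mod m, (a * b' + b * d') mod m,
       (c * a' + d * c') mod m, (c * b' + d * d') mod m)" for a b c d a' b' c' d'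
    by (simp add: SL2_def R.res_add_eq R.res_mult_eq mod_add_eq)
  have cong: "[x mod m = x] (mod 8)" for x
    using m(1) by (simp add: cong_def mod_mod_cancel)
  have one: "\<one>\<^bsub>?G\<^esub> = (1, 0, 0, 1)"
    by (simp add: SL2_def R.res_one_eq R.res_zero_eq)
  have id: "rho (1, 0, 0, 1) = 1"
    by (simp add: factor_def matT_pow_values matS_matS)
  have T: "rho (1, 1, 0, 1) = matT"
    by (simp add: factor_def matT_pow_values matS_matS)
  have "rho (0, m - 1, 1, 0) = matS"
    by (simp add: factor_def matT_pow_values)
  moreover have "(0, m - 1, 1, 0) \<in> carrier ?G"
    using m(2) by (simp add: carrier cong_def)
  moreover show u: "(1, 1, 0, 1) \<in> carrier ?G"
    using m(2) by (simp add: carrier)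
  \<comment> \<open>The upper right entries are -1 and 1.\<close>
  moreover have "matT * matS \<noteq> matS * matT"
    by (simp add: matT_def matS_def mat2_defs)
  ultimately have noncomm: "\<exists>x\<in>carrier ?G. \<exists>y\<in>carrier ?G. rho x * rho y \<noteq> rho y * rho x"
    using T by metis
  have "rho (x \<otimes>\<^bsub>?G\<^esub> y) = rho x * rho y" if xy: "x \<in> carrier ?G" "y \<in> carrier ?G" for x y
  proof -
    obtain a b c d a' b' c' d' where eq: "x = (a, b, c, d)" "y = (a', b', c', d')"
      by (cases x, cases y)
    have "[a * d - b * c = 1] (mod 8)" "[a' * d' - b' * c' = 1] (mod 8)"
      using xy m(1) unfolding eq carrier by (blast intro: cong_dvd_modulus)+
    note rho_mult[OF this]
    moreover have "rho (x \<otimes>\<^bsub>?G\<^esub> y) =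
        rho (a * a' + b * c', a * b' + b * d', c * a' + d * c', c * b' + d * d')"
      unfolding eq mult by (intro rho_cong cong)
    ultimately show ?thesis by (simp only: eq)
  qed
  then show "noncommutative_rep ?G rho"
    using noncomm id by (simp add: noncommutative_rep_def one del: rho.simps)
  show "trace_mat2 (rho (1, 1, 0, 1)) = \<theta>"
    unfolding T by (simp add: matT_def trace_mat2_def)
qed

theorem corollary1p3:
  fixes r :: nat
  assumes "r > 1"
  shows "\<not> complex_algebra_isomorphic
           (complex_group_algebra (SL2 (residue_ring (2 ^ (2 * r)))))
           (complex_group_algebra (SL2 (truncated_poly_ring (residue_ring 2) (2 * r))))"
proof
  let ?G = "SL2 (residue_ring (2 ^ (2 * r)))"
  let ?R = "truncated_poly_ring (residue_ring 2) (2 * r)"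
  assume iso: "complex_algebra_isomorphic (complex_group_algebra ?G) (complex_group_algebra (SL2 ?R))"
  \<comment> \<open>From r > 1 the exponent is at least 3.\<close>
  have m: "8 dvd (2::int) ^ (2 * r)" "(2::int) ^ (2 * r) > 1"
    using le_imp_power_dvd[of 3 "2 * r" "2::int"] assms by simp_all
  interpret Z: residues "2 ^ (2 * r)" "residue_ring (2 ^ (2 * r))"
    by unfold_locales (rule m)
  obtain t where "char2_truncated ?R t (2 * r)"
    using char2_truncated_poly_ring by blast
  then interpret R: char2_truncated ?R t "2 * r" .
  obtain F where F: "\<And>\<rho>. noncommutative_rep ?G \<rho> \<Longrightarrow> noncommutative_rep (SL2 ?R) (F \<rho>)"
    "\<And>\<rho> \<rho>' g. noncommutative_rep ?G \<rho> \<Longrightarrow> noncommutative_rep ?G \<rho>' \<Longrightarrow>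
      (\<And>h. h \<in> carrier (SL2 ?R) \<Longrightarrow> trace_mat2 (F \<rho> h) = trace_mat2 (F \<rho>' h)) \<Longrightarrow>
      g \<in> carrier ?G \<Longrightarrow> trace_mat2 (\<rho> g) = trace_mat2 (\<rho>' g)"
    by (rule transfer_noncommutative_reps[OF iso group.is_monoid[OF Z.group_SL2]
          group.is_monoid[OF R.group_SL2]]) blast
  \<comment> \<open>The three roots of the cubic equation, giving three characters on one
    side.\<close>
  define \<Theta> where "\<Theta> = {0, \<i> * complex_of_real (sqrt 2), - (\<i> * complex_of_real (sqrt 2))}"
  have sqrt2: "complex_of_real (sqrt 2) * complex_of_real (sqrt 2) = 2"
    by (simp flip: of_real_mult)
  have \<Theta>: "theta_rep \<theta>" if "\<theta> \<in> \<Theta>" for \<theta>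
    using that sqrt2 by unfold_locales (auto simp: \<Theta>_def algebra_simps)
  define \<epsilon> where "\<epsilon> \<theta> = F (theta_rep.rho \<theta>) (R.upper t)" for \<theta>
  note rep = theta_rep.noncommutative_rep_rho[OF \<Theta> m]
  have char2_rep: "char2_rep ?R t (2 * r) (F (theta_rep.rho \<theta>))" if "\<theta> \<in> \<Theta>" for \<theta>
    by unfold_locales (intro F(1) rep(1) that)
  \<comment> \<open>Equal images of u(t) force equal characters by \<open>R.trace_eqI\<close>. These
    pull back to equal traces at the upper unipotent with entry 1, and those traces are the roots.
    Three roots would then inject into two signs.\<close>
  have "inj_on \<epsilon> \<Theta>"
  proof (rule inj_onI)
    fix \<theta> \<theta>' assume \<theta>: "\<theta> \<in> \<Theta>" "\<theta>' \<in> \<Theta>" and "\<epsilon> \<theta> = \<epsilon> \<theta>'"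
    then have "trace_mat2 (F (theta_rep.rho \<theta>) h) = trace_mat2 (F (theta_rep.rho \<theta>') h)"
      if "h \<in> carrier (SL2 ?R)" for h
      using that by (intro R.trace_eqI char2_rep) (auto simp: \<epsilon>_def)
    then have "trace_mat2 (theta_rep.rho \<theta> (1, 1, 0, 1)) = trace_mat2 (theta_rep.rho \<theta>' (1, 1, 0, 1))"
      by (rule F(2)[OF rep(1)[OF \<theta>(1)] rep(1)[OF \<theta>(2)] _ rep(2)[OF \<theta>(1)]])
    then show "\<theta> = \<theta>'" using rep(3) \<theta> by simp
  qed
  moreover have "\<epsilon> ` \<Theta> \<subseteq> {1, - 1}"
    using char2_rep.U_t_square_and_t(2)[OF char2_rep]
    by (auto simp: \<epsilon>_def char2_rep.U_def[OF char2_rep])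
  ultimately have "card \<Theta> \<le> card {1, - 1 :: mat2}"
    by (intro card_inj_on_le) auto
  also have "\<dots> \<le> 2" by (simp add: card_insert_if)
  finally show False by (simp add: \<Theta>_def)
qed

end
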